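(* Let $h_0\in\tilde\Omega^1_{3\times3}$ be in general position. Then for sufficiently small positive $\varepsilon$ there exists a unique solution $\gamma$ of the equation $$\frac{\partial h}{\partial\lambda}=\mathcal V^{+}(\lambda,h)$$ on $[-\varepsilon,\varepsilon]$ such that $\gamma(0)=h_0$.
   Context: Fix an orthonormal basis $(e_1,e_2,e_3)$ of $\mathbb R^3$; $(x,y,z)$ is the mixed (triple) product, $\times$ the cross product, a dot denotes $d/dt$, $t\in[a,b]$. $\Omega^1_{3\times3}$ is the Banach space $(C^1[a,b])^9$ of tuples $h=(h_{11},h_{12},\dots,h_{33})$ with norm $\|h\|=\max_{i,j}\max(\sup|h_{ij}|,\sup|\dot h_{ij}|)$. To $h$ associate the three $C^1$ vector functions $u=(h_{11},h_{12},h_{13})$, $v=(h_{21},h_{22},h_{23})$, $w=(h_{31},h_{32},h_{33})$ (coordinates in $(e_1,e_2,e_3)$). (For a 2-ribbon surface $f=(f_0,f_1,f_2)$ these play the role of $u=\dot f_1$, $v=\Delta f_0=f_1-f_0$, $w=\Delta f_1=f_2-f_1$.) $h$ is in general position if $\delta:=(u,v,w)=\det(h_{ij})\ne0$ for every $t\in[a,b]$. $\tilde\Omega^1_{3\times3}=\{h\in\Omega^1_{3\times3}: h_{12}(a)=h_{13}(a)=h_{23}(a)=0\}$, with the induced norm. System A (for a given $h$ in general position) is the following linear system of ODEs on $[a,b]$ for functions $G_{ij}(t)$, $1\le i,j\le3$: $$\dot G_{11}=\dot G_{22}=\dot G_{33}=0,$$ $$\dot G_{12}=\Big(\tfrac{(u,\dot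 v,w)}{\delta}+\tfrac{(\dot u,v,w)}{\delta}\Big)G_{12}+\tfrac{(u,v,\dot v)}{\delta}G_{13}-\tfrac{(u,v,\dot u)}{\delta}G_{23},$$ $$\dot G_{13}=\tfrac{(u,\dot w,w)}{\delta}G_{12}+\Big(\tfrac{(u,v,\dot w)}{\delta}+\tfrac{(\dot u,v,w)}{\delta}\Big)G_{13}-\tfrac{(u,\dot u,w)}{\delta}G_{32},$$ $$\dot G_{21}=-\Big(\tfrac{(u,\dot v,w)}{\delta}+\tfrac{(\dot u,v,w)}{\delta}\Big)G_{12}-\tfrac{(u,v,\dot v)}{\delta}G_{13}+\tfrac{(u,v,\dot u)}{\delta}G_{23},$$ $$\dot G_{31}=-\tfrac{(u,\dot w,w)}{\delta}G_{12}-\Big(\tfrac{(u,v,\dot w)}{\delta}+\tfrac{(\dot u,v,w)}{\delta}\Big)G_{13}+\tfrac{(u,\dot u,w)}{\delta}G_{32},$$ $$\dot G_{23}=-\Big(\tfrac{(w,v,u\times v)(u,\dot v,w)}{|u\times v|^2\delta}-\tfrac{(u,w,u\times v)(\dot v,v,w)}{|u\times v|^2\delta}+\tfrac{(u,v\times\dot v,w)}{|u\times v|^2}+\tfrac{(u\times\dot v,v,w)}{|u\times v|^2}+\tfrac{(\dot w,v,w)}{\delta}\Big)G_{12}$$ $$-\Big(\tfrac{(w,v,u\times v)(u,v,\dot v)}{|u\times v|^2\delta}+\tfrac{(u,v,v\times\dot v)}{|u\times v|^2}\Big)G_{13}-\Big(\tfrac{(u,w,u\times v)(u,v,\dot v)}{|u\times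 v|^2\delta}-\tfrac{(u,v,u\times\dot v)}{|u\times v|^2}-\tfrac{(u,v,\dot w)}{\delta}\Big)G_{23},$$ $$\dot G_{32}=-\Big(\tfrac{(v,w,u\times w)(u,\dot w,w)}{|u\times w|^2\delta}+\tfrac{(u,w,w\times\dot w)}{|u\times w|^2}\Big)G_{12}$$ $$-\Big(\tfrac{(v,w,u\times w)(u,v,\dot w)}{|u\times w|^2\delta}-\tfrac{(u,v,u\times w)(\dot w,v,w)}{|u\times w|^2\delta}+\tfrac{(u,w\times\dot w,v)}{|u\times w|^2}+\tfrac{(u\times\dot w,w,v)}{|u\times w|^2}+\tfrac{(\dot v,v,w)}{\delta}\Big)G_{13}$$ $$-\Big(\tfrac{(u,v,u\times w)(u,\dot w,w)}{|u\times w|^2\delta}-\tfrac{(u,w,u\times\dot w)}{|u\times w|^2}-\tfrac{(u,\dot v,w)}{\delta}\Big)G_{32}.$$ The operator $\mathcal V^{+}$ is defined for $h$ in general position and does not depend on $\lambda$ (it is autonomous): for $1\le l,m\le3$, $$\mathcal V^{+}_{l,m}(\lambda,h)=\frac{(e_m,v,w)}{\delta}G_{l1}(h)+\frac{(u,e_m,w)}{\delta}G_{l2}(h)+\frac{(u,v,e_m)}{\delta}G_{l3}(h),$$ where $(G_{ij}(h))$ is the solution of System A with initial values at $t=a$: $G_{32}(a)=(u(a),v(a),w(a))$ and $G_{ij}(a)=0$ for all $(i,j)\ne(3,2)$. For $h\in\tilde\Omega^1_{3\times3}$ in general position, $\mathcal V^+(\lambda,h)\in\tilde\Omega^1_{3\times3}$.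 A solution on $[-\varepsilon,\varepsilon]$ is a differentiable curve in the set of points of $\tilde\Omega^1_{3\times3}$ in general position satisfying the equation for all $\lambda\in[-\varepsilon,\varepsilon]$. *)

theory Defs
  imports "HOL-Analysis.Analysis"
begin

unbundle cross3_syntax

text \<open>
  \<open>\<real>\<^sup>3\<close> is \<open>real^3\<close>, with \<open>e\<^sub>i = axis i 1\<close>. A tuple \<open>h = (h\<^sub>1\<^sub>1, h\<^sub>1\<^sub>2, \<dots>, h\<^sub>3\<^sub>3)\<close> of functions
  on \<open>[a,b]\<close> is a matrix-valued function with \<open>h\<^sub>i\<^sub>j(t) = h t $ i $ j\<close>, so that \<open>u, v, w\<close> are
  the rows 1, 2, 3 of \<open>h\<close>. Functions on \<open>[a,b]\<close> are represented extensionally (with the value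
  \<open>undefined\<close> outside \<open>[a,b]\<close>), which makes equality the equality of functions on \<open>[a,b]\<close>.
\<close>

definition mixed :: "real^3 \<Rightarrow> real^3 \<Rightarrow> real^3 \<Rightarrow> real" where
  "mixed x y z = x \<bullet> (y \<times> z)"

definition ddt :: "real \<Rightarrow> real \<Rightarrow> (real \<Rightarrow> 'v::real_normed_vector) \<Rightarrow> real \<Rightarrow> 'v" where
  "ddt a b f t = vector_derivative f (at t within {a..b})"

definition Omega1 :: "real \<Rightarrow> real \<Rightarrow> (real \<Rightarrow> real^3^3) set" where
  "Omega1 a b = {h \<in> extensional {a..b}.
     h differentiable_on {a..b} \<and> continuous_on {a..b} (ddt a b h)}"

text \<open>Only the values on \<open>[a,b]\<close> enter, so this also applies to pointwise linear
  combinations of elements of \<open>Omega1 a b\<close> that are not restricted to \<open>[a,b]\<close>.\<close>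

definition Omega1_norm :: "real \<Rightarrow> real \<Rightarrow> (real \<Rightarrow> real^3^3) \<Rightarrow> real" where
  "Omega1_norm a b h =
     (MAX (i, j) \<in> UNIV. max (SUP t\<in>{a..b}. \<bar>h t $ i $ j\<bar>) (SUP t\<in>{a..b}. \<bar>ddt a b h t $ i $ j\<bar>))"

definition Omega1_tilde :: "real \<Rightarrow> real \<Rightarrow> (real \<Rightarrow> real^3^3) set" where
  "Omega1_tilde a b = {h \<in> Omega1 a b. h a $ 1 $ 2 = 0 \<and> h a $ 1 $ 3 = 0 \<and> h a $ 2 $ 3 = 0}"

definition delta :: "real^3^3 \<Rightarrow> real" where
  "delta H = mixed (H $ 1) (H $ 2) (H $ 3)"

lemma delta_eq_det: "delta H = det H"
  by (simp add: delta_def mixed_def cross3_def inner_vec_def det_3 sum_3 algebra_simps)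

definition general_position :: "real \<Rightarrow> real \<Rightarrow> (real \<Rightarrow> real^3^3) \<Rightarrow> bool" where
  "general_position a b h \<longleftrightarrow> (\<forall>t\<in>{a..b}. delta (h t) \<noteq> 0)"

text \<open>The right-hand side of System A at one time, as the matrix of the \<open>\<dot>G\<^sub>i\<^sub>j\<close>: \<open>H\<close> holds the rows
  \<open>u, v, w\<close>, \<open>H'\<close> their time derivatives \<open>u', v', w'\<close>, and \<open>G\<close> the unknowns.\<close>

definition system_A_rhs :: "real^3^3 \<Rightarrow> real^3^3 \<Rightarrow> real^3^3 \<Rightarrow> real^3^3" where
  "system_A_rhs H H' G =
   (let u = H $ 1; v = H $ 2; w = H $ 3;
        u' = H' $ 1; v' = H' $ 2; w' = H' $ 3;
        \<delta> = mixed u v w;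
        uv2 = (norm (u \<times> v))\<^sup>2; uw2 = (norm (u \<times> w))\<^sup>2;
        G12 = G $ 1 $ 2; G13 = G $ 1 $ 3; G23 = G $ 2 $ 3; G32 = G $ 3 $ 2;
        dG12 = (mixed u v' w / \<delta> + mixed u' v w / \<delta>) * G12
             + mixed u v v' / \<delta> * G13
             - mixed u v u' / \<delta> * G23;
        dG13 = mixed u w' w / \<delta> * G12
             + (mixed u v w' / \<delta> + mixed u' v w / \<delta>) * G13
             - mixed u u' w / \<delta> * G32;
        dG21 = - (mixed u v' w / \<delta> + mixed u' v w / \<delta>) * G12
             - mixed u v v' / \<delta> * G13
             + mixed u v u' / \<delta> * G23;
        dG31 = - (mixed u w' w / \<delta>) * G12
             - (mixed u v w' / \<delta> + mixed u' v w / \<delta>) * G13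
             + mixed u u' w / \<delta> * G32;
        dG23 = - (mixed w v (u \<times> v) * mixed u v' w / (uv2 * \<delta>)
                  - mixed u w (u \<times> v) * mixed v' v w / (uv2 * \<delta>)
                  + mixed u (v \<times> v') w / uv2
                  + mixed (u \<times> v') v w / uv2
                  + mixed w' v w / \<delta>) * G12
             - (mixed w v (u \<times> v) * mixed u v v' / (uv2 * \<delta>)
                  + mixed u v (v \<times> v') / uv2) * G13
             - (mixed u w (u \<times> v) * mixed u v v' / (uv2 * \<delta>)
                  - mixed u v (u \<times> v') / uv2
                  - mixed u v w' / \<delta>) * G23;
        dG32 = - (mixed v w (u \<times> w) * mixed u w' w / (uw2 * \<delta>)
                  + mixed u w (w \<times> w') / uw2) * G12
             - (mixed v w (u \<times> w) * mixed u v w' / (uw2 * \<delta>)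
                  - mixed u v (u \<times> w) * mixed w' v w / (uw2 * \<delta>)
                  + mixed u (w \<times> w') v / uw2
                  + mixed (u \<times> w') w v / uw2
                  + mixed v' v w / \<delta>) * G13
             - (mixed u v (u \<times> w) * mixed u w' w / (uw2 * \<delta>)
                  - mixed u w (u \<times> w') / uw2
                  - mixed u v' w / \<delta>) * G32
    in vector [vector [0,    dG12, dG13],
               vector [dG21, 0,    dG23],
               vector [dG31, dG32, 0   ]])"

definition solves_system_A ::
  "real \<Rightarrow> real \<Rightarrow> (real \<Rightarrow> real^3^3) \<Rightarrow> (real \<Rightarrow> real^3^3) \<Rightarrow> bool" where
  "solves_system_A a b h G \<longleftrightarrow>
     (\<forall>t\<in>{a..b}. (G has_vector_derivative system_A_rhs (h t) (ddt a b h t) (G t)) (at t within {a..b}))"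

definition G_plus :: "real \<Rightarrow> real \<Rightarrow> (real \<Rightarrow> real^3^3) \<Rightarrow> real \<Rightarrow> real^3^3" where
  "G_plus a b h =
     (THE G. G \<in> extensional {a..b} \<and> solves_system_A a b h G \<and>
        (\<forall>i j. G a $ i $ j = (if (i, j) = (3, 2) then delta (h a) else 0)))"

text \<open>The argument \<open>\<lambda>\<close> is kept although the operator does not depend on it.\<close>

definition V_plus :: "real \<Rightarrow> real \<Rightarrow> real \<Rightarrow> (real \<Rightarrow> real^3^3) \<Rightarrow> real \<Rightarrow> real^3^3" where
  "V_plus a b lam h =
     (\<lambda>t\<in>{a..b}. \<chi> l m.
        (let u = h t $ 1; v = h t $ 2; w = h t $ 3; e = axis m 1; G = G_plus a b h t
         in mixed e v w / delta (h t) * G $ l $ 1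
          + mixed u e w / delta (h t) * G $ l $ 2
          + mixed u v e / delta (h t) * G $ l $ 3))"

text \<open>\<open>D\<close> is the derivative at \<open>lam\<close> (relative to \<open>S\<close>) of the curve \<open>\<gamma>\<close> in the Banach space
  \<open>Omega1 a b\<close>: the difference quotients converge to \<open>D\<close> in its norm.\<close>

definition has_Omega1_derivative ::
  "real \<Rightarrow> real \<Rightarrow> (real \<Rightarrow> real \<Rightarrow> real^3^3) \<Rightarrow> (real \<Rightarrow> real^3^3) \<Rightarrow> real \<Rightarrow> real set \<Rightarrow> bool" where
  "has_Omega1_derivative a b \<gamma> D lam S \<longleftrightarrow>
     D \<in> Omega1 a b \<and>
     ((\<lambda>\<mu>. Omega1_norm a b (\<lambda>t. (\<gamma> \<mu> t - \<gamma> lam t) /\<^sub>R (\<mu> - lam) - D t)) \<longlongrightarrow> 0) (at lam within S)"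

text \<open>Curves are likewise extensional on \<open>[-\<epsilon>,\<epsilon>]\<close>.\<close>

definition V_plus_solution ::
  "real \<Rightarrow> real \<Rightarrow> real \<Rightarrow> (real \<Rightarrow> real \<Rightarrow> real^3^3) \<Rightarrow> bool" where
  "V_plus_solution a b \<epsilon> \<gamma> \<longleftrightarrow>
     \<gamma> \<in> {-\<epsilon>..\<epsilon>} \<rightarrow>\<^sub>E {h \<in> Omega1_tilde a b. general_position a b h} \<and>
     (\<forall>lam\<in>{-\<epsilon>..\<epsilon>}. has_Omega1_derivative a b \<gamma> (V_plus a b lam (\<gamma> lam)) lam {-\<epsilon>..\<epsilon>})"

end

theory Submission
  imports Defs
begin

text \<open>
  The equation is an ordinary differential equation in the Banach space of \<open>C\<^sup>1\<close> tuples, so the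
  Picard theorem (\<open>autonomous_flow_exists\<close>, \<open>autonomous_flow_unique\<close>) applies as soon as
  \<open>V_plus\<close> is Lipschitz in the \<open>C\<^sup>1\<close> norm near the tuples in question. That is the content of
  \<open>V_plus_lipschitz\<close>, and it rests on the absence of a loss of derivatives. At each time,
  \<open>V_plus\<close> is a rational function of \<open>h(t)\<close> and the solution \<open>G(t)\<close> of System A. Its time derivative
  involves \<open>\<dot>G\<close>, which System A expresses through \<open>h\<close>, \<open>\<dot>h\<close> and \<open>G\<close>; so the derivative, too, is a
  rational function of \<open>h\<close>, \<open>\<dot>h\<close> and \<open>G\<close>, and its denominators vanish only where \<open>delta\<close> does. On
  the compact set of data with norms at most \<open>C\<close> and \<open>\<bar>delta\<bar> \<ge> c > 0\<close> these functions are Lipschitz,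
  and by Gronwall's inequality \<open>G\<close> depends on \<open>h\<close> in a Lipschitz way.

  The Lipschitz constant depends only on \<open>C\<close> and \<open>c\<close>, and all estimates are pointwise in time, so
  \<open>V_plus\<close> is Lipschitz on the whole, not necessarily convex, set of tuples with these bounds
  (\<open>nondegenerate\<close>). A small ball around \<open>h0\<close> lies in such a set (\<open>nondegenerate_cball\<close>), which
  gives solutions for small \<open>\<epsilon>\<close>. They stay in \<open>Omega1_tilde\<close> because the first two rows of
  \<open>V_plus\<close> vanish at \<open>t = a\<close> (\<open>V_plus_initial_row\<close>). Any two solutions on \<open>[-\<epsilon>,\<epsilon>]\<close> trace compact
  curves of tuples in general position and so lie in a common set of this kind
  (\<open>nondegenerate_compact_curve\<close>), which gives uniqueness on the entire interval.

  A \<open>C\<^sup>1\<close> tuple \<open>h\<close> is represented by the pair \<open>(h(a), \<dot>h)\<close> in the product of the matrices with the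
  bounded continuous functions, a complete space in which \<open>has_Omega1_derivative\<close> becomes the ordinary
  vector derivative (\<open>has_Omega1_derivative_iff\<close>).
\<close>

section \<open>Differential equations in Banach spaces\<close>

text \<open>
  The mean value inequality, with one-sided derivatives at the end points, so that it applies to
  solutions of differential equations on closed intervals.
\<close>

lemma norm_increment_le:
  fixes f :: "real \<Rightarrow> 'a::real_normed_vector"
  assumes "A \<le> B"
    and f: "\<And>s. s \<in> {A..B} \<Longrightarrow> (f has_vector_derivative f' s) (at s within {A..B})"
    and g: "\<And>s. s \<in> {A..B} \<Longrightarrow> (g has_vector_derivative g' s) (at s within {A..B})"
    and le: "\<And>s. s \<in> {A..B} \<Longrightarrow> norm (f' s) \<le> g' s"
  shows "norm (f B - f A) \<le> g B - g A"
proof (cases "A = B")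
  case False
  then have "A < B" using assms(1) by simp
  moreover have "continuous_on {A..B} f"
    using f continuous_on_eq_continuous_within has_vector_derivative_continuous by blast
  moreover have "continuous_on {A..B} g"
    using g continuous_on_eq_continuous_within has_vector_derivative_continuous by blast
  moreover have "(f has_vector_derivative f' s) (at s)" if "A < s" "s < B" for s
    using f[of s] that by (simp add: at_within_Icc_at)
  moreover have "(g has_vector_derivative g' s) (at s)" if "A < s" "s < B" for s
    using g[of s] that by (simp add: at_within_Icc_at)
  ultimately show ?thesis
    by (rule differentiable_bound_general) (use le in auto)
qed simp

text \<open>
  A differential form of Gronwall's inequality, valid for any norm. The weight
  \<open>exp (2 * L * (s - A))\<close> replaces the usual iteration: if \<open>m\<close> is the maximum of the weighted norm of
  \<open>y\<close>, the term \<open>L * norm (y s)\<close> contributes at most \<open>m / 2\<close> to \<open>m\<close> itself and can be absorbed. The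
  price is a factor 2 and an exponent twice the optimal one.
\<close>

lemma gronwall_bound:
  fixes y :: "real \<Rightarrow> 'a::real_normed_vector"
  assumes AB: "A \<le> B" and L: "0 < L" and c: "0 \<le> c"
    and y: "\<And>t. t \<in> {A..B} \<Longrightarrow> (y has_vector_derivative y' t) (at t within {A..B})"
    and le: "\<And>t. t \<in> {A..B} \<Longrightarrow> norm (y' t) \<le> L * norm (y t) + c"
    and t: "t \<in> {A..B}"
  shows "norm (y t) \<le> 2 * (norm (y A) + c * (B - A)) * exp (2 * L * (B - A))"
proof -
  define e where "e s = exp (2 * L * (s - A))" for s
  have e_pos: "e s > 0" for s by (simp add: e_def)
  have cont: "continuous_on {A..B} y"
    using y continuous_on_eq_continuous_within has_vector_derivative_continuous by blast
  have "continuous_on {A..B} (\<lambda>s. norm (y s) / e s)"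
    using e_pos by (intro continuous_intros cont) (auto simp: e_def intro!: continuous_intros)
  from continuous_attains_sup[OF compact_Icc _ this] AB obtain T
    where T: "T \<in> {A..B}" and max: "\<And>s. s \<in> {A..B} \<Longrightarrow> norm (y s) / e s \<le> norm (y T) / e T"
    by fastforce
  define m where "m = norm (y T) / e T"
  have m0: "m \<ge> 0" using e_pos[of T] by (simp add: m_def)
  have y_le: "norm (y s) \<le> m * e s" if "s \<in> {A..B}" for s
    using max[OF that] e_pos[of s] by (simp add: m_def[symmetric] divide_le_eq)
  define g where "g s = m / 2 * e s + c * s" for s
  define g' where "g' s = L * (m * e s) + c" for s
  have "norm (y T - y A) \<le> g T - g A"
  proof (rule norm_increment_le)
    show "A \<le> T" using T by simp
    show "(y has_vector_derivative y' s) (at s within {A..T})" if "s \<in> {A..T}" for s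
      by (rule has_vector_derivative_within_subset[OF y]) (use that T in auto)
    show "(g has_vector_derivative g' s) (at s within {A..T})" if "s \<in> {A..T}" for s
      unfolding g_def g'_def e_def has_real_derivative_iff_has_vector_derivative[symmetric]
      by (auto intro!: derivative_eq_intros simp: algebra_simps)
    show "norm (y' s) \<le> g' s" if "s \<in> {A..T}" for s
    proof -
      have s: "s \<in> {A..B}" using that T by auto
      have "norm (y' s) \<le> L * norm (y s) + c" by (rule le[OF s])
      also have "\<dots> \<le> L * (m * e s) + c" using y_le[OF s] L by (simp add: mult_left_mono)
      finally show ?thesis by (simp add: g'_def)
    qed
  qed
  then have "norm (y T) \<le> norm (y A) + (g T - g A)"
    by (smt (verit) norm_triangle_sub)
  also have "g T - g A = m / 2 * (e T - 1) + c * (T - A)"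
    by (simp add: g_def e_def algebra_simps)
  also have "\<dots> \<le> m / 2 * e T + c * (B - A)"
    using m0 c T by (intro add_mono mult_left_mono) auto
  finally have "norm (y T) \<le> (norm (y A) + c * (B - A)) + m / 2 * e T" by simp
  then have "m \<le> (norm (y A) + c * (B - A)) / e T + m / 2"
    using e_pos[of T] by (simp add: m_def field_simps)
  also have "(norm (y A) + c * (B - A)) / e T \<le> (norm (y A) + c * (B - A)) / 1"
    using e_pos[of T] T L c AB by (intro divide_left_mono) (auto simp: e_def)
  finally have m_le: "m \<le> 2 * (norm (y A) + c * (B - A))" by simp
  have "norm (y t) \<le> m * e t" by (rule y_le[OF t])
  also have "\<dots> \<le> 2 * (norm (y A) + c * (B - A)) * exp (2 * L * (B - A))"
    using m_le m0 t L by (intro mult_mono) (auto simp: e_def)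
  finally show ?thesis .
qed

text \<open>
  The Picard iteration is a contraction on the whole interval, however long, in the norm weighted by
  \<open>exp (- 2 * L * (t - A))\<close>; the fixed point sought is the weighted function \<open>y\<close>, and \<open>X y\<close> removes
  the weight. A general closed set \<open>S\<close> of values serves two purposes: \<open>S = UNIV\<close> gives the global
  solutions of linear systems, and a ball gives the local solutions of equations that are Lipschitz
  only near the initial value.
\<close>

lemma picard_forward:
  fixes f :: "real \<Rightarrow> 'a::banach \<Rightarrow> 'a"
  assumes AB: "A \<le> B" and L: "0 < L" and S: "closed S" "x0 \<in> S"
    and cont: "\<And>x. continuous_on {A..B} x \<Longrightarrow> x \<in> {A..B} \<rightarrow> S \<Longrightarrow> continuous_on {A..B} (\<lambda>t. f t (x t))"
    and lip: "\<And>t x y. t \<in> {A..B} \<Longrightarrow> x \<in> S \<Longrightarrow> y \<in> S \<Longrightarrow> norm (f t x - f t y) \<le> L * norm (x - y)"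
    and inv: "\<And>x t. continuous_on {A..B} x \<Longrightarrow> x \<in> {A..B} \<rightarrow> S \<Longrightarrow> t \<in> {A..B} \<Longrightarrow>
                x0 + integral {A..t} (\<lambda>s. f s (x s)) \<in> S"
  obtains x where "x A = x0" "x \<in> {A..B} \<rightarrow> S"
    "\<And>t. t \<in> {A..B} \<Longrightarrow> (x has_vector_derivative f t (x t)) (at t within {A..B})"
proof -
  define e where "e s = exp (2 * L * (s - A))" for s
  have e_pos: "e s > 0" for s by (simp add: e_def)
  have e_nz: "e s \<noteq> 0" for s by (simp add: e_def)
  have e_cont: "continuous_on U e" for U unfolding e_def by (intro continuous_intros)
  define X where "X y t = e t *\<^sub>R apply_bcontfun y t" for y :: "real \<Rightarrow>\<^sub>C 'a" and t
  have X_cont: "continuous_on {A..B} (X y)" for y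
    unfolding X_def by (intro continuous_intros e_cont continuous_on_apply_bcontfun)
  define I where "I y t = integral {A..t} (\<lambda>s. f s (X y s))" for y t
  define T where "T y t = (1 / e t) *\<^sub>R (x0 + I y t)" for y t
  define W where "W = PiC {A..B} (\<lambda>t. (\<lambda>v. e t *\<^sub>R v) -` S)"
  have W_iff: "y \<in> W \<longleftrightarrow> X y \<in> {A..B} \<rightarrow> S" for y
    by (simp add: W_def mem_PiC_iff X_def Pi_iff)
  have W_closed: "closed W"
    unfolding W_def by (intro closed_PiC closed_vimage S continuous_intros)
  have fX: "continuous_on {A..B} (\<lambda>s. f s (X y s))" if "y \<in> W" for y
    by (rule cont[OF X_cont]) (use that in \<open>simp add: W_iff\<close>)
  have I_deriv: "(I y has_vector_derivative f t (X y t)) (at t within {A..B})"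
    if "y \<in> W" "t \<in> {A..B}" for y t
    unfolding I_def by (rule integral_has_vector_derivative[OF fX[OF that(1)] that(2)])
  have I_cont: "continuous_on {A..B} (I y)" if "y \<in> W" for y
    using I_deriv[OF that] continuous_on_eq_continuous_within has_vector_derivative_continuous by blast
  have T_cont: "continuous_on (cbox A B) (T y)" if "y \<in> W" for y
    unfolding T_def box_real by (intro continuous_intros e_cont I_cont that) (simp add: e_nz)
  \<comment> \<open>Functions on the interval become bounded continuous functions on the line by constant extension.\<close>
  have "\<exists>g. \<forall>x. apply_bcontfun g x = T y (clamp A B x)" if "y \<in> W" for y
    by (rule continuous_on_cbox_bcontfunE[OF T_cont[OF that]]) blast
  then obtain P where P: "\<And>y x. y \<in> W \<Longrightarrow> apply_bcontfun (P y) x = T y (clamp A B x)"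
    by metis
  have clamp_in: "clamp A B x \<in> {A..B}" for x
    using clamp_in_interval[of A B x] AB by simp
  have clamp_id: "clamp A B x = x" if "x \<in> {A..B}" for x
    using clamp_cancel_cbox[of x A B] that by simp
  have XP: "X (P y) t = x0 + I y t" if "y \<in> W" "t \<in> {A..B}" for y t
    using e_pos[of t] by (simp add: X_def P[OF that(1)] clamp_id[OF that(2)] T_def)
  have PW: "P y \<in> W" if "y \<in> W" for y
  proof -
    have "x0 + I y t \<in> S" if "t \<in> {A..B}" for t
      unfolding I_def by (rule inv[OF X_cont _ that]) (use \<open>y \<in> W\<close> in \<open>simp add: W_iff\<close>)
    then show ?thesis
      unfolding W_iff using XP[OF that] by (simp add: Pi_iff)
  qed
  have contr: "dist (P y) (P z) \<le> 1/2 * dist y z" if y: "y \<in> W" and z: "z \<in> W" for y z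
  proof (rule dist_bound)
    fix x
    define t where "t = clamp A B x"
    have t: "t \<in> {A..B}" using clamp_in by (simp add: t_def)
    define d where "d = dist y z"
    have d0: "d \<ge> 0" by (simp add: d_def)
    define g where "g s = d / 2 * e s" for s
    define g' where "g' s = L * (d * e s)" for s
    have "norm ((I y t - I z t) - (I y A - I z A)) \<le> g t - g A"
    proof (rule norm_increment_le)
      show "A \<le> t" using t by simp
      show "((\<lambda>s. I y s - I z s) has_vector_derivative f s (X y s) - f s (X z s)) (at s within {A..t})"
        if "s \<in> {A..t}" for s
        by (rule has_vector_derivative_within_subset[OF
              has_vector_derivative_diff[OF I_deriv[OF y] I_deriv[OF z]]]) (use that t in auto)
      show "(g has_vector_derivative g' s) (at s within {A..t})" if "s \<in> {A..t}" for s
        unfolding g_def g'_def e_def has_real_derivative_iff_has_vector_derivative[symmetric]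
        by (auto intro!: derivative_eq_intros simp: algebra_simps)
      show "norm (f s (X y s) - f s (X z s)) \<le> g' s" if "s \<in> {A..t}" for s
      proof -
        have s: "s \<in> {A..B}" using that t by auto
        have "norm (f s (X y s) - f s (X z s)) \<le> L * norm (X y s - X z s)"
          using s y z by (intro lip) (auto simp: W_iff)
        also have "norm (X y s - X z s) = e s * dist (apply_bcontfun y s) (apply_bcontfun z s)"
          using e_pos[of s] by (simp add: X_def dist_norm flip: scaleR_diff_right)
        also have "\<dots> \<le> e s * d"
          unfolding d_def using e_pos[of s] by (intro mult_left_mono dist_bounded) auto
        finally show ?thesis using L by (simp add: g'_def mult.commute)
      qed
    qed
    moreover have "I y A = 0" "I z A = 0" by (simp_all add: I_def)
    moreover have "g A \<ge> 0" using d0 e_pos[of A] by (simp add: g_def)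
    ultimately have "norm (I y t - I z t) \<le> d / 2 * e t"
      by (simp add: g_def)
    then have "norm (I y t - I z t) / e t \<le> d / 2"
      using e_pos[of t] by (simp add: divide_le_eq)
    moreover have "dist (apply_bcontfun (P y) x) (apply_bcontfun (P z) x) = norm (I y t - I z t) / e t"
      using e_pos[of t] by (simp add: P y z t_def[symmetric] T_def dist_norm flip: scaleR_diff_right)
    ultimately show "dist (apply_bcontfun (P y) x) (apply_bcontfun (P z) x) \<le> 1/2 * dist y z"
      by (simp add: d_def)
  qed
  have "W \<noteq> {}"
  proof -
    have "continuous_on (cbox A B) (\<lambda>t. (1 / e t) *\<^sub>R x0)"
      by (intro continuous_intros e_cont) (simp add: e_nz)
    then obtain g where "\<And>t. t \<in> cbox A B \<Longrightarrow> apply_bcontfun g t = (1 / e t) *\<^sub>R x0"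
      by (rule continuous_on_cbox_bcontfunE) blast
    then have "g \<in> W" using S(2) by (auto simp: W_iff X_def e_nz)
    then show ?thesis by blast
  qed
  then obtain y where y: "y \<in> W" "P y = y"
    using Banach_fix[of W "1/2" P] W_closed contr PW
    by (auto simp: complete_eq_closed image_subset_iff)
  have Xy: "X y t = x0 + I y t" if "t \<in> {A..B}" for t
    using XP[OF y(1) that] y(2) by simp
  show ?thesis
  proof
    show "X y A = x0" using Xy[of A] AB by (simp add: I_def)
    show "X y \<in> {A..B} \<rightarrow> S" using y(1) by (simp add: W_iff)
    show "(X y has_vector_derivative f t (X y t)) (at t within {A..B})" if "t \<in> {A..B}" for t
    proof (rule has_vector_derivative_transform[OF that])
      show "X y s = x0 + I y s" if "s \<in> {A..B}" for s using Xy[OF that] by simp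
      show "((\<lambda>s. x0 + I y s) has_vector_derivative f t (X y t)) (at t within {A..B})"
        using has_vector_derivative_add[OF has_vector_derivative_const I_deriv[OF y(1) that]]
        by simp
    qed
  qed
qed

instance bcontfun :: (metric_space, banach) banach ..

lemma has_vector_derivative_reflect:
  fixes y :: "real \<Rightarrow> 'a::real_normed_vector"
  assumes "(y has_vector_derivative y') (at (- t) within {- B..- A})"
  shows "((\<lambda>s. y (- s)) has_vector_derivative - y') (at t within {A..B})"
proof -
  have "(uminus has_vector_derivative - 1) (at t within {A..B})"
    by (auto intro!: derivative_eq_intros)
  from vector_diff_chain_within[OF this, of y y'] assms show ?thesis
    by (simp add: comp_def)
qed

text \<open>
  The backward half of the solution is the forward solution for the field \<open>- F\<close>, run in reverse. The
  condition \<open>\<epsilon> * M \<le> R\<close> keeps the Picard iterates in the ball.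
\<close>

lemma autonomous_flow_exists:
  fixes F :: "'a::banach \<Rightarrow> 'a"
  assumes "0 \<le> \<epsilon>" "0 \<le> R" "\<epsilon> * M \<le> R" "0 < L"
    and lip: "\<And>x y. x \<in> cball x0 R \<Longrightarrow> y \<in> cball x0 R \<Longrightarrow> norm (F x - F y) \<le> L * norm (x - y)"
    and M: "\<And>x. x \<in> cball x0 R \<Longrightarrow> norm (F x) \<le> M"
  obtains y where "y 0 = x0" "y \<in> {-\<epsilon>..\<epsilon>} \<rightarrow> cball x0 R"
    "\<And>t. t \<in> {-\<epsilon>..\<epsilon>} \<Longrightarrow> (y has_vector_derivative F (y t)) (at t within {-\<epsilon>..\<epsilon>})"
proof -
  have x0: "x0 \<in> cball x0 R" using assms by simp
  have M0: "0 \<le> M" using M[OF x0] norm_ge_zero order_trans by blast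
  have lip': "L-lipschitz_on (cball x0 R) F"
    using lip assms by (intro lipschitz_onI) (auto simp: dist_norm)
  have half: "\<exists>x. x 0 = x0 \<and> x \<in> {0..\<epsilon>} \<rightarrow> cball x0 R \<and>
      (\<forall>t\<in>{0..\<epsilon>}. (x has_vector_derivative r *\<^sub>R F (x t)) (at t within {0..\<epsilon>}))"
    if r: "\<bar>r\<bar> = 1" for r
  proof (rule picard_forward[of 0 \<epsilon> L "cball x0 R" x0 "\<lambda>_ x. r *\<^sub>R F x"])
    show cont: "continuous_on {0..\<epsilon>} (\<lambda>t. r *\<^sub>R F (x t))"
      if "continuous_on {0..\<epsilon>} x" "x \<in> {0..\<epsilon>} \<rightarrow> cball x0 R" for x
      using that by (intro continuous_intros continuous_on_compose2[OF lipschitz_on_continuous_on[OF lip']]) auto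
    show "norm (r *\<^sub>R F x - r *\<^sub>R F y) \<le> L * norm (x - y)" if "x \<in> cball x0 R" "y \<in> cball x0 R" for x y
      using lip[OF that] r by (simp flip: scaleR_diff_right)
    show "x0 + integral {0..t} (\<lambda>s. r *\<^sub>R F (x s)) \<in> cball x0 R"
      if x: "continuous_on {0..\<epsilon>} x" "x \<in> {0..\<epsilon>} \<rightarrow> cball x0 R" and t: "t \<in> {0..\<epsilon>}" for x t
    proof -
      have "norm (integral {0..t} (\<lambda>s. r *\<^sub>R F (x s))) \<le> M * (t - 0)"
      proof (rule integral_bound)
        show "continuous_on {0..t} (\<lambda>s. r *\<^sub>R F (x s))"
          by (rule continuous_on_subset[OF cont[OF x]]) (use t in auto)
        show "norm (r *\<^sub>R F (x s)) \<le> M" if "s \<in> {0..t}" for s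
          using M[OF funcset_mem[OF x(2)], of s] that t r by simp
      qed (use t in auto)
      also have "\<dots> \<le> R" using t M0 assms(3) mult_left_mono[of t \<epsilon> M] by (simp add: mult.commute)
      finally show ?thesis by (simp add: dist_norm)
    qed
  qed (use assms x0 in auto)
  obtain p where p: "p 0 = x0" "p \<in> {0..\<epsilon>} \<rightarrow> cball x0 R"
    "\<And>t. t \<in> {0..\<epsilon>} \<Longrightarrow> (p has_vector_derivative F (p t)) (at t within {0..\<epsilon>})"
    using half[of 1] by auto
  obtain q where q: "q 0 = x0" "q \<in> {0..\<epsilon>} \<rightarrow> cball x0 R"
    "\<And>t. t \<in> {0..\<epsilon>} \<Longrightarrow> (q has_vector_derivative - F (q t)) (at t within {0..\<epsilon>})"
    using half[of "- 1"] by auto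
  define y where "y t = (if t \<in> {0..\<epsilon>} then p t else q (- t))" for t
  show ?thesis
  proof
    show "y 0 = x0" using assms(1) p(1) by (simp add: y_def)
    show "y \<in> {-\<epsilon>..\<epsilon>} \<rightarrow> cball x0 R"
      using p(2) q(2) by (auto simp: y_def Pi_iff simp del: mem_cball)
    fix t assume t: "t \<in> {-\<epsilon>..\<epsilon>}"
    have "((\<lambda>t. if t \<in> {0..\<epsilon>} then p t else q (- t)) has_vector_derivative
        (if t \<in> {0..\<epsilon>} then F (p t) else F (q (- t)))) (at t within {-\<epsilon>..\<epsilon>})"
    proof (rule has_vector_derivative_If_within_closures[where T = "{-\<epsilon>..0}"])
      have eq: "{0..\<epsilon>} \<union> closure {0..\<epsilon>} \<inter> closure {-\<epsilon>..0} = {0..\<epsilon>}"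
        "{-\<epsilon>..0} \<union> closure {0..\<epsilon>} \<inter> closure {-\<epsilon>..0} = {-\<epsilon>..0}"
        using assms(1) by auto
      show "t \<in> {0..\<epsilon>} \<union> {-\<epsilon>..0}" "{-\<epsilon>..\<epsilon>} = {0..\<epsilon>} \<union> {-\<epsilon>..0}"
        using t assms(1) by auto
      show "(p has_vector_derivative F (p t)) (at t within {0..\<epsilon>} \<union> closure {0..\<epsilon>} \<inter> closure {-\<epsilon>..0})"
        if "t \<in> {0..\<epsilon>} \<union> closure {0..\<epsilon>} \<inter> closure {-\<epsilon>..0}"
        using p(3)[of t] that unfolding eq by simp
      show "((\<lambda>t. q (- t)) has_vector_derivative F (q (- t)))
          (at t within {-\<epsilon>..0} \<union> closure {0..\<epsilon>} \<inter> closure {-\<epsilon>..0})"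
        if "t \<in> {-\<epsilon>..0} \<union> closure {0..\<epsilon>} \<inter> closure {-\<epsilon>..0}"
        using has_vector_derivative_reflect[of q "- F (q (- t))" t 0 "- \<epsilon>"] q(3)[of "- t"] that
        unfolding eq by simp
      show "p t = q (- t)" "F (p t) = F (q (- t))"
        if "t \<in> closure {0..\<epsilon>}" "t \<in> closure {-\<epsilon>..0}"
      proof -
        have "t = 0" using that by simp
        then show "p t = q (- t)" "F (p t) = F (q (- t))" using p(1) q(1) by simp_all
      qed
    qed
    then show "(y has_vector_derivative F (y t)) (at t within {-\<epsilon>..\<epsilon>})"
      by (simp add: y_def[abs_def] if_distrib[of F])
  qed
qed

text \<open>
  The set \<open>U\<close> is arbitrary because the field of interest is Lipschitz on sets, given by inequalities
  that hold uniformly in time, which contain both curves but are neither convex nor neighbourhoods of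
  them.
\<close>

lemma autonomous_flow_unique:
  fixes F :: "'a::real_normed_vector \<Rightarrow> 'a"
  assumes "0 < L"
    and lip: "\<And>x y. x \<in> U \<Longrightarrow> y \<in> U \<Longrightarrow> norm (F x - F y) \<le> L * norm (x - y)"
    and y: "y \<in> {-\<epsilon>..\<epsilon>} \<rightarrow> U"
      "\<And>t. t \<in> {-\<epsilon>..\<epsilon>} \<Longrightarrow> (y has_vector_derivative F (y t)) (at t within {-\<epsilon>..\<epsilon>})"
    and z: "z \<in> {-\<epsilon>..\<epsilon>} \<rightarrow> U"
      "\<And>t. t \<in> {-\<epsilon>..\<epsilon>} \<Longrightarrow> (z has_vector_derivative F (z t)) (at t within {-\<epsilon>..\<epsilon>})"
    and "y 0 = z 0" and t: "t \<in> {-\<epsilon>..\<epsilon>}"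
  shows "y t = z t"
proof -
  define x where "x t = y t - z t" for t
  have x: "(x has_vector_derivative F (y t) - F (z t)) (at t within {-\<epsilon>..\<epsilon>})" if "t \<in> {-\<epsilon>..\<epsilon>}" for t
    unfolding x_def by (intro has_vector_derivative_diff y z that)
  have le: "norm (F (y t) - F (z t)) \<le> L * norm (x t) + 0" if "t \<in> {-\<epsilon>..\<epsilon>}" for t
    using lip[OF funcset_mem[OF y(1) that] funcset_mem[OF z(1) that]] by (simp add: x_def)
  have x0: "x 0 = 0" using assms(7) by (simp add: x_def)
  have "x t = 0"
  proof (cases "0 \<le> t")
    case True
    have "norm (x t) \<le> 2 * (norm (x 0) + 0 * (\<epsilon> - 0)) * exp (2 * L * (\<epsilon> - 0))"
    proof (rule gronwall_bound)
      show "(x has_vector_derivative F (y s) - F (z s)) (at s within {0..\<epsilon>})" if "s \<in> {0..\<epsilon>}" for s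
        by (rule has_vector_derivative_within_subset[OF x]) (use that in auto)
      show "norm (F (y s) - F (z s)) \<le> L * norm (x s) + 0" if "s \<in> {0..\<epsilon>}" for s
        by (rule le) (use that in auto)
    qed (use True t assms(1) in auto)
    then show ?thesis by (simp add: x0)
  next
    case False
    let ?x = "\<lambda>s. x (- s)"
    have "norm (?x (- t)) \<le> 2 * (norm (?x 0) + 0 * (\<epsilon> - 0)) * exp (2 * L * (\<epsilon> - 0))"
    proof (rule gronwall_bound)
      show "(?x has_vector_derivative - (F (y (- s)) - F (z (- s)))) (at s within {0..\<epsilon>})"
        if "s \<in> {0..\<epsilon>}" for s
        by (intro has_vector_derivative_reflect has_vector_derivative_within_subset[OF x]) (use that in auto)
      show "norm (- (F (y (- s)) - F (z (- s)))) \<le> L * norm (?x s) + 0" if "s \<in> {0..\<epsilon>}" for s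
        using le[of "- s"] that by (simp add: norm_minus_commute)
    qed (use False t assms(1) in auto)
    then show ?thesis by (simp add: x0)
  qed
  then show ?thesis by (simp add: x_def)
qed

section \<open>Bounded Lipschitz functions\<close>

text \<open>
  The right-hand side of System A is a long rational expression. Being bounded and Lipschitz
  is a property that passes through products and, on compact sets, through quotients with
  nonvanishing denominators, so that Lipschitz estimates follow from the syntactic form alone. A bound
  on the derivative would give a Lipschitz estimate only on convex sets, and
  \<open>\<bar>delta H\<bar> \<ge> c\<close> does not describe a convex set.
\<close>

definition bounded_lipschitz :: "'a::metric_space set \<Rightarrow> ('a \<Rightarrow> 'b::real_normed_vector) \<Rightarrow> bool" where
  "bounded_lipschitz S f \<longleftrightarrow> bounded (f ` S) \<and> (\<exists>L. L-lipschitz_on S f)"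

lemma bounded_lipschitzE:
  assumes "bounded_lipschitz S f"
  obtains L where "L > 0" "\<And>x. x \<in> S \<Longrightarrow> norm (f x) \<le> L"
    "\<And>x y. x \<in> S \<Longrightarrow> y \<in> S \<Longrightarrow> norm (f x - f y) \<le> L * dist x y"
proof -
  obtain B where B: "B > 0" "\<And>x. x \<in> S \<Longrightarrow> norm (f x) \<le> B"
    using assms unfolding bounded_lipschitz_def bounded_pos by auto
  obtain L where L: "L-lipschitz_on S f"
    using assms unfolding bounded_lipschitz_def by blast
  show ?thesis
  proof
    show "max B L > 0" using B by simp
    show "norm (f x) \<le> max B L" if "x \<in> S" for x using B(2)[OF that] by simp
    show "norm (f x - f y) \<le> max B L * dist x y" if "x \<in> S" "y \<in> S" for x y
      using lipschitz_onD[OF lipschitz_on_le[OF L, of "max B L"] that] by (simp add: dist_norm)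
  qed
qed

lemma bounded_lipschitzI:
  assumes "\<And>x. x \<in> S \<Longrightarrow> norm (f x) \<le> B"
    and "\<And>x y. x \<in> S \<Longrightarrow> y \<in> S \<Longrightarrow> norm (f x - f y) \<le> L * dist x y" and "L \<ge> 0"
  shows "bounded_lipschitz S f"
  using assms unfolding bounded_lipschitz_def bounded_iff lipschitz_on_def dist_norm by auto

lemma bounded_lipschitz_imp_continuous_on: "bounded_lipschitz S f \<Longrightarrow> continuous_on S f"
  using lipschitz_on_continuous_on unfolding bounded_lipschitz_def by blast

lemma bounded_lipschitz_const: "bounded_lipschitz S (\<lambda>x. c)"
  by (rule bounded_lipschitzI[where B = "norm c" and L = 0]) auto

lemma bounded_lipschitz_minus:
  "bounded_lipschitz S f \<Longrightarrow> bounded_lipschitz S (\<lambda>x. - f x)"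
  using lipschitz_on_minus unfolding bounded_lipschitz_def
  by (auto simp: bounded_iff)

lemma bounded_lipschitz_add:
  assumes "bounded_lipschitz S f" "bounded_lipschitz S g"
  shows "bounded_lipschitz S (\<lambda>x. f x + g x)"
proof -
  obtain L where L: "L > 0" "\<And>x. x \<in> S \<Longrightarrow> norm (f x) \<le> L"
    "\<And>x y. x \<in> S \<Longrightarrow> y \<in> S \<Longrightarrow> norm (f x - f y) \<le> L * dist x y"
    by (rule bounded_lipschitzE[OF assms(1)]) blast
  obtain M where M: "M > 0" "\<And>x. x \<in> S \<Longrightarrow> norm (g x) \<le> M"
    "\<And>x y. x \<in> S \<Longrightarrow> y \<in> S \<Longrightarrow> norm (g x - g y) \<le> M * dist x y"
    by (rule bounded_lipschitzE[OF assms(2)]) blast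
  show ?thesis
  proof (rule bounded_lipschitzI)
    show "norm (f x + g x) \<le> L + M" if "x \<in> S" for x
      using L(2) M(2) that by (intro norm_triangle_mono)
    show "norm (f x + g x - (f y + g y)) \<le> (L + M) * dist x y" if "x \<in> S" "y \<in> S" for x y
      using norm_triangle_mono[OF L(3)[OF that] M(3)[OF that]] by (simp add: algebra_simps)
    show "0 \<le> L + M" using L M by simp
  qed
qed

lemma bounded_lipschitz_diff:
  "bounded_lipschitz S f \<Longrightarrow> bounded_lipschitz S g \<Longrightarrow> bounded_lipschitz S (\<lambda>x. f x - g x)"
  using bounded_lipschitz_add[OF _ bounded_lipschitz_minus] by fastforce

lemma bounded_lipschitz_bilinear:
  assumes "bounded_bilinear p" "bounded_lipschitz S f" "bounded_lipschitz S g"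
  shows "bounded_lipschitz S (\<lambda>x. p (f x) (g x))"
proof -
  interpret bounded_bilinear p by fact
  obtain L where L: "L > 0" "\<And>x. x \<in> S \<Longrightarrow> norm (f x) \<le> L"
    "\<And>x y. x \<in> S \<Longrightarrow> y \<in> S \<Longrightarrow> norm (f x - f y) \<le> L * dist x y"
    by (rule bounded_lipschitzE[OF assms(2)]) blast
  obtain M where M: "M > 0" "\<And>x. x \<in> S \<Longrightarrow> norm (g x) \<le> M"
    "\<And>x y. x \<in> S \<Longrightarrow> y \<in> S \<Longrightarrow> norm (g x - g y) \<le> M * dist x y"
    by (rule bounded_lipschitzE[OF assms(3)]) blast
  obtain K where K: "K > 0" "\<And>a b. norm (p a b) \<le> norm a * norm b * K"
    using pos_bounded by blast
  have bd: "norm (p a b) \<le> A * B * K" if "norm a \<le> A" "norm b \<le> B" for a b A B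
  proof -
    have "norm a * norm b * K \<le> A * B * K"
      using that K(1) by (intro mult_right_mono mult_mono) (auto intro: order_trans[OF norm_ge_zero])
    then show ?thesis using K(2) order_trans by blast
  qed
  show ?thesis
  proof (rule bounded_lipschitzI)
    show "norm (p (f x) (g x)) \<le> L * M * K" if "x \<in> S" for x
      using bd L(2) M(2) that by blast
    show "norm (p (f x) (g x) - p (f y) (g y)) \<le> (2 * (L * M * K)) * dist x y"
      if "x \<in> S" "y \<in> S" for x y
    proof -
      have "p (f x) (g x) - p (f y) (g y) = p (f x - f y) (g x) + p (f y) (g x - g y)"
        by (simp add: diff_left diff_right)
      moreover have "norm (p (f x - f y) (g x)) \<le> (L * dist x y) * M * K"
        using bd L(3) M(2) that by blast
      moreover have "norm (p (f y) (g x - g y)) \<le> L * (M * dist x y) * K"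
        using bd L(2) M(3) that by blast
      ultimately show ?thesis
        using norm_triangle_ineq[of "p (f x - f y) (g x)" "p (f y) (g x - g y)"]
        by (simp add: algebra_simps)
    qed
    show "0 \<le> 2 * (L * M * K)" using L M K by simp
  qed
qed

lemma bounded_lipschitz_linear:
  assumes "bounded_linear T" "bounded_lipschitz S f"
  shows "bounded_lipschitz S (\<lambda>x. T (f x))"
proof -
  have "bounded_bilinear (\<lambda>r x. r *\<^sub>R T x)"
    using bounded_bilinear.comp[OF bounded_bilinear_scaleR bounded_linear_ident assms(1)] .
  from bounded_lipschitz_bilinear[OF this bounded_lipschitz_const[of _ 1] assms(2)]
  show ?thesis by simp
qed

lemma bounded_lipschitz_self: "bounded S \<Longrightarrow> bounded_lipschitz S (\<lambda>x. x)"
  unfolding bounded_lipschitz_def using lipschitz_on_id by auto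

lemma bounded_lipschitz_inverse:
  fixes f :: "'a::metric_space \<Rightarrow> real"
  assumes "compact S" "bounded_lipschitz S f" "\<And>x. x \<in> S \<Longrightarrow> f x \<noteq> 0"
  shows "bounded_lipschitz S (\<lambda>x. inverse (f x))"
proof (cases "S = {}")
  case False
  obtain L where L: "L > 0" "\<And>x. x \<in> S \<Longrightarrow> norm (f x) \<le> L"
    "\<And>x y. x \<in> S \<Longrightarrow> y \<in> S \<Longrightarrow> norm (f x - f y) \<le> L * dist x y"
    by (rule bounded_lipschitzE[OF assms(2)]) blast
  have "continuous_on S f"
    by (rule bounded_lipschitz_imp_continuous_on[OF assms(2)])
  then have "continuous_on S (\<lambda>x. \<bar>f x\<bar>)" by (intro continuous_intros)
  from continuous_attains_inf[OF assms(1) False this]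
  obtain x0 where "x0 \<in> S" and min: "\<And>x. x \<in> S \<Longrightarrow> \<bar>f x0\<bar> \<le> \<bar>f x\<bar>" by blast
  define m where "m = \<bar>f x0\<bar>"
  have m: "m > 0" using \<open>x0 \<in> S\<close> assms(3) by (simp add: m_def)
  show ?thesis
  proof (rule bounded_lipschitzI)
    show "norm (inverse (f x)) \<le> inverse m" if "x \<in> S" for x
      using min[OF that] m assms(3)[OF that] by (simp add: m_def)
    show "norm (inverse (f x) - inverse (f y)) \<le> (inverse m * L * inverse m) * dist x y"
      if "x \<in> S" "y \<in> S" for x y
    proof -
      have "norm (inverse (f x) - inverse (f y))
          = \<bar>inverse (f x)\<bar> * \<bar>f x - f y\<bar> * \<bar>inverse (f y)\<bar>"
        using assms(3) that by (subst inverse_diff_inverse) (simp_all add: abs_mult)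
      also have "\<dots> \<le> inverse m * (L * dist x y) * inverse m"
        using min m L(1,3) assms(3) that by (intro mult_mono) (auto simp: m_def less_imp_le)
      finally show ?thesis by (simp add: mult_ac)
    qed
    show "0 \<le> inverse m * L * inverse m" using m L by simp
  qed
qed (simp add: bounded_lipschitz_def exI[of _ 0])

lemma bounded_lipschitz_divide:
  fixes f g :: "'a::metric_space \<Rightarrow> real"
  assumes "compact S" "bounded_lipschitz S f" "bounded_lipschitz S g" "\<And>x. x \<in> S \<Longrightarrow> g x \<noteq> 0"
  shows "bounded_lipschitz S (\<lambda>x. f x / g x)"
  unfolding divide_inverse
  by (intro bounded_lipschitz_bilinear[OF bounded_bilinear_mult] bounded_lipschitz_inverse assms)

lemma bounded_lipschitz_vec:
  fixes f :: "'a::metric_space \<Rightarrow> 'b::real_normed_vector ^ 'n::finite"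
  assumes "\<And>i. bounded_lipschitz S (\<lambda>x. f x $ i)"
  shows "bounded_lipschitz S f"
proof -
  have "\<exists>L>0. (\<forall>x\<in>S. norm (f x $ i) \<le> L) \<and>
      (\<forall>x\<in>S. \<forall>y\<in>S. norm (f x $ i - f y $ i) \<le> L * dist x y)" for i
    using assms[of i] by (auto elim!: bounded_lipschitzE)
  then obtain L where L: "\<And>i. L i > 0" "\<And>i x. x \<in> S \<Longrightarrow> norm (f x $ i) \<le> L i"
    "\<And>i x y. x \<in> S \<Longrightarrow> y \<in> S \<Longrightarrow> norm (f x $ i - f y $ i) \<le> L i * dist x y"
    by metis
  have norm_le: "norm v \<le> (\<Sum>i\<in>UNIV. norm (v $ i))" for v :: "'b ^ 'n"
    unfolding norm_vec_def by (rule L2_set_le_sum) simp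
  show ?thesis
  proof (rule bounded_lipschitzI)
    show "norm (f x) \<le> sum L UNIV" if "x \<in> S" for x
      using norm_le[of "f x"] sum_mono[of UNIV "\<lambda>i. norm (f x $ i)" L] L(2)[OF that]
      by fastforce
    show "norm (f x - f y) \<le> sum L UNIV * dist x y" if "x \<in> S" "y \<in> S" for x y
    proof -
      have "norm (f x - f y) \<le> (\<Sum>i\<in>UNIV. norm (f x $ i - f y $ i))"
        using norm_le[of "f x - f y"] by simp
      also have "\<dots> \<le> (\<Sum>i\<in>UNIV. L i * dist x y)"
        by (intro sum_mono L(3) that)
      finally show ?thesis by (simp add: sum_distrib_right)
    qed
    show "0 \<le> sum L UNIV" using L(1) by (simp add: sum_nonneg less_imp_le)
  qed
qed

lemma bounded_bilinear_cross3: "bounded_bilinear (\<times>)"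
  using bilinear_cross bilinear_conv_bounded_bilinear by blast

lemma bounded_lipschitz_mixed:
  assumes "bounded_lipschitz S u" "bounded_lipschitz S v" "bounded_lipschitz S w"
  shows "bounded_lipschitz S (\<lambda>x. mixed (u x) (v x) (w x))"
  unfolding mixed_def
  by (intro bounded_lipschitz_bilinear[OF bounded_bilinear_inner]
      bounded_lipschitz_bilinear[OF bounded_bilinear_cross3] assms)

lemmas bounded_lipschitz_intros =
  bounded_lipschitz_const bounded_lipschitz_minus bounded_lipschitz_add bounded_lipschitz_diff
  bounded_lipschitz_bilinear[OF bounded_bilinear_mult]
  bounded_lipschitz_bilinear[OF bounded_bilinear_scaleR]
  bounded_lipschitz_bilinear[OF bounded_bilinear_inner]
  bounded_lipschitz_bilinear[OF bounded_bilinear_cross3]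
  bounded_lipschitz_mixed bounded_lipschitz_divide
  bounded_lipschitz_linear[OF bounded_linear_fst] bounded_lipschitz_linear[OF bounded_linear_snd]
  bounded_lipschitz_linear[OF bounded_linear_vec_nth]

section \<open>Regularity of System A and of the field in the pointwise data\<close>

text \<open>
  All denominators in System A vanish only where \<open>delta\<close> does.
\<close>

lemma delta_eq_0_if_cross_eq_0:
  "H $ 1 \<times> H $ 2 = 0 \<Longrightarrow> delta H = 0" "H $ 1 \<times> H $ 3 = 0 \<Longrightarrow> delta H = 0"
proof -
  have "delta H = H $ 3 \<bullet> (H $ 1 \<times> H $ 2)" "delta H = - (H $ 2 \<bullet> (H $ 1 \<times> H $ 3))"
    by (simp_all add: delta_def mixed_def cross3_simps)
  then show "H $ 1 \<times> H $ 2 = 0 \<Longrightarrow> delta H = 0" "H $ 1 \<times> H $ 3 = 0 \<Longrightarrow> delta H = 0"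
    by auto
qed

lemma system_A_rhs_bounded_lipschitz:
  fixes S :: "((real^3^3) \<times> (real^3^3) \<times> (real^3^3)) set"
  assumes S: "compact S" and \<delta>: "\<And>x. x \<in> S \<Longrightarrow> delta (fst x) \<noteq> 0"
  shows "bounded_lipschitz S (\<lambda>x. system_A_rhs (fst x) (fst (snd x)) (snd (snd x)))"
proof -
  have self: "bounded_lipschitz S (\<lambda>x. x)"
    by (intro bounded_lipschitz_self compact_imp_bounded S)
  have nz: "mixed (fst x $ 1) (fst x $ 2) (fst x $ 3) \<noteq> 0"
    "fst x $ 1 \<times> fst x $ 2 \<noteq> 0" "fst x $ 1 \<times> fst x $ 3 \<noteq> 0" if "x \<in> S" for x
    using \<delta>[OF that] delta_eq_0_if_cross_eq_0[of "fst x"] by (auto simp: delta_def)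
  have "bounded_lipschitz S
      (\<lambda>x. system_A_rhs (fst x) (fst (snd x)) (snd (snd x)) $ i $ j)" for i j
    using exhaust_3[of i] exhaust_3[of j] unfolding system_A_rhs_def Let_def power2_norm_eq_inner
    by (elim disjE; simp only: vector_3; intro bounded_lipschitz_intros S self; simp add: nz)
  then show ?thesis
    by (intro bounded_lipschitz_vec)
qed

lemma linear_system_A_rhs: "linear (system_A_rhs H H')"
proof (rule linearI)
  show "system_A_rhs H H' (G1 + G2) = system_A_rhs H H' G1 + system_A_rhs H H' G2" for G1 G2
    unfolding system_A_rhs_def Let_def vec_eq_iff forall_3 vector_3 vector_add_component distrib_left
    by (simp only: algebra_simps add_0_left)
  show "system_A_rhs H H' (r *\<^sub>R G) = r *\<^sub>R system_A_rhs H H' G" for r G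
    unfolding system_A_rhs_def Let_def vec_eq_iff forall_3 vector_3 vector_scaleR_component
      real_scaleR_def
    by (intro conjI; (simp only: mult_zero_right)?; (simp only: right_diff_distrib distrib_left mult.left_commute)?)
qed

text \<open>
  The coordinates of \<open>e\<^sub>m\<close> in the basis \<open>u, v, w\<close> are the \<open>m\<close>-th components of the dual basis
  \<open>v \<times> w / delta\<close>, \<open>w \<times> u / delta\<close>, \<open>u \<times> v / delta\<close>. So each row of \<open>V_plus\<close> is the corresponding
  row of \<open>G\<close> expanded in the dual basis, a form that is easy to differentiate.
\<close>

definition V_field :: "real^3^3 \<Rightarrow> real^3^3 \<Rightarrow> real^3^3" where
  "V_field H G = (\<chi> l. (1 / delta H) *\<^sub>R (G $ l $ 1 *\<^sub>R (H $ 2 \<times> H $ 3)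
      + G $ l $ 2 *\<^sub>R (H $ 3 \<times> H $ 1) + G $ l $ 3 *\<^sub>R (H $ 1 \<times> H $ 2)))"

lemma V_field_nth:
  "V_field H G $ l $ m = mixed (axis m 1) (H $ 2) (H $ 3) / delta H * G $ l $ 1
    + mixed (H $ 1) (axis m 1) (H $ 3) / delta H * G $ l $ 2
    + mixed (H $ 1) (H $ 2) (axis m 1) / delta H * G $ l $ 3"
proof -
  have "mixed (axis m 1) v w = (v \<times> w) $ m" "mixed u (axis m 1) w = (w \<times> u) $ m"
    "mixed u v (axis m 1) = (u \<times> v) $ m" for u v w
    using exhaust_3[of m] by (auto simp: mixed_def cross3_simps axis_def)
  then show ?thesis by (simp add: V_field_def field_simps)
qed

lemma has_vector_derivative_vec:
  fixes f :: "real \<Rightarrow> 'a::real_normed_vector ^ 'n::finite"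
  assumes "\<And>i. ((\<lambda>t. f t $ i) has_vector_derivative f' $ i) (at t within T)"
  shows "(f has_vector_derivative f') (at t within T)"
  unfolding has_vector_derivative_def has_derivative_within
proof (intro conjI bounded_linear_scaleR_left vec_tendstoI)
  fix i
  show "((\<lambda>y. ((1 / norm (y - t)) *\<^sub>R (f y - (f t + (y - t) *\<^sub>R f'))) $ i) \<longlongrightarrow> 0 $ i) (at t within T)"
    using assms[of i] unfolding has_vector_derivative_def has_derivative_within by simp
qed

lemma delta_has_vector_derivative:
  assumes "(h has_vector_derivative H') (at t within T)"
  shows "((\<lambda>t. delta (h t)) has_vector_derivative
     mixed (H' $ 1) (h t $ 2) (h t $ 3) + mixed (h t $ 1) (H' $ 2) (h t $ 3)
       + mixed (h t $ 1) (h t $ 2) (H' $ 3)) (at t within T)"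
proof -
  note row = bounded_linear.has_vector_derivative[OF bounded_linear_vec_nth assms]
  show ?thesis unfolding delta_def mixed_def
    by (rule has_vector_derivative_eq_rhs[OF
          bounded_bilinear.has_vector_derivative[OF bounded_bilinear_inner row[of 1]
            bounded_bilinear.has_vector_derivative[OF bounded_bilinear_cross3 row[of 2] row[of 3]]]])
      (simp add: inner_add_right)
qed

text \<open>
  The derivative of \<open>V_field\<close> along a curve \<open>(H, G)\<close> with velocity \<open>(H', G')\<close>.
\<close>

definition V_field' :: "real^3^3 \<Rightarrow> real^3^3 \<Rightarrow> real^3^3 \<Rightarrow> real^3^3 \<Rightarrow> real^3^3" where
  "V_field' H H' G G' = (\<chi> l.
     (1 / delta H) *\<^sub>R
       ((G $ l $ 1 *\<^sub>R (H $ 2 \<times> H' $ 3 + H' $ 2 \<times> H $ 3) + G' $ l $ 1 *\<^sub>R (H $ 2 \<times> H $ 3))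
      + (G $ l $ 2 *\<^sub>R (H $ 3 \<times> H' $ 1 + H' $ 3 \<times> H $ 1) + G' $ l $ 2 *\<^sub>R (H $ 3 \<times> H $ 1))
      + (G $ l $ 3 *\<^sub>R (H $ 1 \<times> H' $ 2 + H' $ 1 \<times> H $ 2) + G' $ l $ 3 *\<^sub>R (H $ 1 \<times> H $ 2)))
     + (- (mixed (H' $ 1) (H $ 2) (H $ 3) + mixed (H $ 1) (H' $ 2) (H $ 3)
           + mixed (H $ 1) (H $ 2) (H' $ 3)) / (delta H * delta H)) *\<^sub>R
       (G $ l $ 1 *\<^sub>R (H $ 2 \<times> H $ 3) + G $ l $ 2 *\<^sub>R (H $ 3 \<times> H $ 1) + G $ l $ 3 *\<^sub>R (H $ 1 \<times> H $ 2)))"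

lemma V_field_has_vector_derivative:
  assumes h: "(h has_vector_derivative H') (at t within T)"
    and G: "(G has_vector_derivative G') (at t within T)" and nz: "delta (h t) \<noteq> 0"
  shows "((\<lambda>t. V_field (h t) (G t)) has_vector_derivative V_field' (h t) H' (G t) G') (at t within T)"
proof (rule has_vector_derivative_vec)
  fix l
  note row = bounded_linear.has_vector_derivative[OF bounded_linear_vec_nth h]
  have entry: "((\<lambda>t. G t $ l $ k) has_real_derivative G' $ l $ k) (at t within T)" for k
    unfolding has_real_derivative_iff_has_vector_derivative
    by (intro bounded_linear.has_vector_derivative[OF bounded_linear_vec_nth] G)
  have inv: "((\<lambda>t. 1 / delta (h t)) has_real_derivative
     - (mixed (H' $ 1) (h t $ 2) (h t $ 3) + mixed (h t $ 1) (H' $ 2) (h t $ 3)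
         + mixed (h t $ 1) (h t $ 2) (H' $ 3)) / (delta (h t) * delta (h t))) (at t within T)"
    using DERIV_divide[OF DERIV_const[of 1] delta_has_vector_derivative[OF h,
        folded has_real_derivative_iff_has_vector_derivative] nz] by simp
  note cross = bounded_bilinear.has_vector_derivative[OF bounded_bilinear_cross3 row row]
  show "((\<lambda>t. V_field (h t) (G t) $ l) has_vector_derivative V_field' (h t) H' (G t) G' $ l)
      (at t within T)"
    unfolding V_field_def V_field'_def vec_lambda_beta
    by (intro has_vector_derivative_scaleR has_vector_derivative_add inv entry cross)
qed

text \<open>
  With \<open>G'\<close> eliminated by System A, also the time derivative of the field is a rational function of
  \<open>h\<close>, \<open>h'\<close> and \<open>G\<close>. No second derivative of \<open>h\<close> enters, which is why the field preserves the class
  \<open>C\<^sup>1\<close>.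
\<close>

lemma V_field_bounded_lipschitz:
  fixes S :: "((real^3^3) \<times> (real^3^3) \<times> (real^3^3)) set"
  assumes S: "compact S" and \<delta>: "\<And>x. x \<in> S \<Longrightarrow> delta (fst x) \<noteq> 0"
  shows "bounded_lipschitz S (\<lambda>x. V_field (fst x) (snd (snd x)))"
    and "bounded_lipschitz S (\<lambda>x. V_field' (fst x) (fst (snd x)) (snd (snd x))
           (system_A_rhs (fst x) (fst (snd x)) (snd (snd x))))"
proof -
  have self: "bounded_lipschitz S (\<lambda>x. x)"
    by (intro bounded_lipschitz_self compact_imp_bounded S)
  have nz: "mixed (fst x $ 1) (fst x $ 2) (fst x $ 3) \<noteq> 0" if "x \<in> S" for x
    using \<delta>[OF that] by (simp add: delta_def)
  show "bounded_lipschitz S (\<lambda>x. V_field (fst x) (snd (snd x)))"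
    unfolding V_field_def delta_def
    by (rule bounded_lipschitz_vec, unfold vec_lambda_beta,
        intro bounded_lipschitz_intros self S, simp add: nz)
  show "bounded_lipschitz S (\<lambda>x. V_field' (fst x) (fst (snd x)) (snd (snd x))
           (system_A_rhs (fst x) (fst (snd x)) (snd (snd x))))"
    unfolding V_field'_def delta_def
    by (rule bounded_lipschitz_vec, unfold vec_lambda_beta,
        intro bounded_lipschitz_intros self S system_A_rhs_bounded_lipschitz \<delta>; simp add: nz)
qed

text \<open>
  The image of a compact interval is a compact set on which \<open>delta\<close> does not vanish, so the Lipschitz
  calculus also provides continuity in time.
\<close>

lemma continuous_along_curve:
  fixes \<Phi> :: "(real^3^3) \<times> (real^3^3) \<times> (real^3^3) \<Rightarrow> real^3^3" and h h' G :: "real \<Rightarrow> real^3^3"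
  assumes \<Phi>: "\<And>S. compact S \<Longrightarrow> (\<And>x. x \<in> S \<Longrightarrow> delta (fst x) \<noteq> 0) \<Longrightarrow> bounded_lipschitz S \<Phi>"
    and "continuous_on {a..b} h" "continuous_on {a..b} h'" "continuous_on {a..b} G"
    and "\<And>t. t \<in> {a..b} \<Longrightarrow> delta (h t) \<noteq> 0"
  shows "continuous_on {a..b} (\<lambda>t. \<Phi> (h t, h' t, G t))"
proof -
  define p where "p t = (h t, h' t, G t)" for t
  have p: "continuous_on {a..b} p" unfolding p_def by (intro continuous_intros assms)
  have "bounded_lipschitz (p ` {a..b}) \<Phi>"
    by (rule \<Phi>) (use assms(5) compact_continuous_image[OF p compact_Icc] in \<open>auto simp: p_def\<close>)
  then have "continuous_on {a..b} (\<Phi> \<circ> p)"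
    by (intro continuous_on_compose p bounded_lipschitz_imp_continuous_on)
  then show ?thesis by (simp add: p_def comp_def)
qed

definition phase :: "real \<Rightarrow> real \<Rightarrow> ((real^3^3) \<times> (real^3^3) \<times> (real^3^3)) set" where
  "phase C c = {(H, H', G). norm H \<le> C \<and> norm H' \<le> C \<and> norm G \<le> C \<and> c \<le> \<bar>delta H\<bar>}"

lemma continuous_on_delta: "continuous_on T h \<Longrightarrow> continuous_on T (\<lambda>x. delta (h x))"
  unfolding delta_def mixed_def by (intro continuous_intros bounded_bilinear.continuous_on[OF bounded_bilinear_cross3])

lemma compact_phase: "compact (phase C c)"
proof -
  have "bounded (cball 0 C :: (real^3^3) set)" by simp
  then have "bounded (Product_Type.Times (cball 0 C) (Product_Type.Times (cball 0 C) (cball 0 C))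
     :: ((real^3^3) \<times> (real^3^3) \<times> (real^3^3)) set)"
    by (intro bounded_Times)
  then have "bounded (phase C c)"
    by (rule bounded_subset) (auto simp: phase_def)
  moreover have "closed (phase C c)"
    unfolding phase_def case_prod_unfold
    by (intro closed_Collect_conj closed_Collect_le continuous_intros continuous_on_delta)
  ultimately show ?thesis by (simp add: compact_eq_bounded_closed)
qed

lemma phase_delta_nonzero: "c > 0 \<Longrightarrow> x \<in> phase C c \<Longrightarrow> delta (fst x) \<noteq> 0"
  by (auto simp: phase_def)

lemma bounded_lipschitz_on_phase:
  assumes "c > 0"
  shows "bounded_lipschitz (phase C c) (\<lambda>x. system_A_rhs (fst x) (fst (snd x)) (snd (snd x)))"
    and "bounded_lipschitz (phase C c) (\<lambda>x. V_field (fst x) (snd (snd x)))"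
    and "bounded_lipschitz (phase C c) (\<lambda>x. V_field' (fst x) (fst (snd x)) (snd (snd x))
           (system_A_rhs (fst x) (fst (snd x)) (snd (snd x))))"
  using system_A_rhs_bounded_lipschitz[OF compact_phase phase_delta_nonzero[OF assms]]
    V_field_bounded_lipschitz[OF compact_phase phase_delta_nonzero[OF assms]] by fastforce+

text \<open>
  By linearity in \<open>G\<close>, a bound on the unit ball gives the linear bound for all \<open>G\<close>.
\<close>

lemma system_A_rhs_linear_bound:
  assumes "c > 0"
  obtains B where "B > 0" "\<And>H H' G. norm H \<le> C \<Longrightarrow> norm H' \<le> C \<Longrightarrow> c \<le> \<bar>delta H\<bar> \<Longrightarrow>
      norm (system_A_rhs H H' G) \<le> B * norm G"
proof -
  obtain B where "B > 0" and B: "\<And>x. x \<in> phase (max C 1) c \<Longrightarrow>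
      norm (system_A_rhs (fst x) (fst (snd x)) (snd (snd x))) \<le> B"
    by (rule bounded_lipschitzE[OF bounded_lipschitz_on_phase(1)[OF assms]]) (rule that)
  have "norm (system_A_rhs H H' G) \<le> B * norm G"
    if "norm H \<le> C" "norm H' \<le> C" "c \<le> \<bar>delta H\<bar>" for H H' G
  proof (cases "G = 0")
    case True
    then show ?thesis using linear_0[OF linear_system_A_rhs] by simp
  next
    case False
    have "norm (system_A_rhs H H' (G /\<^sub>R norm G)) \<le> B"
      using B[of "(H, H', G /\<^sub>R norm G)"] that False by (simp add: phase_def le_max_iff_disj)
    moreover have "system_A_rhs H H' (G /\<^sub>R norm G) = system_A_rhs H H' G /\<^sub>R norm G"
      by (rule linear_cmul[OF linear_system_A_rhs])
    ultimately show ?thesis using False by (simp add: field_simps)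
  qed
  with \<open>B > 0\<close> show ?thesis using that by blast
qed

section \<open>Solutions of System A\<close>

lemma ddt_eqI:
  assumes "a < b" "t \<in> {a..b}" "(f has_vector_derivative f') (at t within {a..b})"
  shows "ddt a b f t = f'"
  unfolding ddt_def using assms vector_derivative_within_cbox[of a b t f f'] by simp

lemma Omega1_has_vector_derivative:
  assumes "h \<in> Omega1 a b" "t \<in> {a..b}"
  shows "(h has_vector_derivative ddt a b h t) (at t within {a..b})"
  using assms unfolding Omega1_def ddt_def differentiable_on_def
  by (auto simp: vector_derivative_works)

lemma Omega1_continuous:
  assumes "h \<in> Omega1 a b"
  shows "continuous_on {a..b} h" "continuous_on {a..b} (ddt a b h)"
  using assms differentiable_imp_continuous_on by (auto simp: Omega1_def)

lemma Omega1I: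
  assumes "a < b" "h \<in> extensional {a..b}" "continuous_on {a..b} h'"
    and h': "\<And>t. t \<in> {a..b} \<Longrightarrow> (h has_vector_derivative h' t) (at t within {a..b})"
  shows "h \<in> Omega1 a b"
proof -
  have "continuous_on {a..b} (ddt a b h)"
    using assms(3) by (rule continuous_on_eq) (simp add: ddt_eqI[OF assms(1) _ h'])
  then show ?thesis
    using assms(2) h' differentiableI_vector unfolding Omega1_def differentiable_on_def by blast
qed

text \<open>
  Quantitative general position. The constants \<open>C\<close> and \<open>c\<close> are what the Lipschitz constants below
  depend on; every tuple in general position satisfies such bounds, and so do small balls and compact
  curves of such tuples.
\<close>

definition nondegenerate :: "real \<Rightarrow> real \<Rightarrow> real \<Rightarrow> real \<Rightarrow> (real \<Rightarrow> real^3^3) set" where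
  "nondegenerate a b C c = {h \<in> Omega1 a b. \<forall>t\<in>{a..b}.
     norm (h t) \<le> C \<and> norm (ddt a b h t) \<le> C \<and> c \<le> \<bar>delta (h t)\<bar>}"

lemma general_position_imp_nondegenerate:
  assumes "a < b" "h \<in> Omega1 a b" "general_position a b h"
  obtains C c where "c > 0" "h \<in> nondegenerate a b C c"
proof -
  have ne: "{a..b} \<noteq> {}" using assms(1) by simp
  note cont = Omega1_continuous[OF assms(2)]
  have "bounded (h ` {a..b})" "bounded (ddt a b h ` {a..b})"
    by (intro compact_imp_bounded compact_continuous_image cont compact_Icc)+
  then obtain C1 C2 where C: "\<And>t. t \<in> {a..b} \<Longrightarrow> norm (h t) \<le> C1"
    "\<And>t. t \<in> {a..b} \<Longrightarrow> norm (ddt a b h t) \<le> C2"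
    unfolding bounded_iff ball_simps by metis
  have "continuous_on {a..b} (\<lambda>t. \<bar>delta (h t)\<bar>)"
    by (intro continuous_intros continuous_on_delta cont)
  from continuous_attains_inf[OF compact_Icc ne this] obtain s where
    s: "s \<in> {a..b}" "\<And>t. t \<in> {a..b} \<Longrightarrow> \<bar>delta (h s)\<bar> \<le> \<bar>delta (h t)\<bar>" by blast
  show ?thesis
  proof (rule that)
    show "\<bar>delta (h s)\<bar> > 0" using s(1) assms(3) by (simp add: general_position_def)
    show "h \<in> nondegenerate a b (max C1 C2) \<bar>delta (h s)\<bar>"
      using C s(2) assms(2) by (auto simp: nondegenerate_def intro: max.coboundedI1 max.coboundedI2)
  qed
qed

definition G_initial :: "real^3^3 \<Rightarrow> real^3^3" where
  "G_initial H = (\<chi> i j. if (i, j) = (3, 2) then delta H else 0)"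

lemma system_A_unique:
  assumes "a < b" "h \<in> Omega1 a b" "general_position a b h"
    and "solves_system_A a b h G1" "solves_system_A a b h G2" "G1 a = G2 a" "t \<in> {a..b}"
  shows "G1 t = G2 t"
proof -
  obtain C c where "c > 0" and h: "h \<in> nondegenerate a b C c"
    by (rule general_position_imp_nondegenerate[OF assms(1-3)])
  obtain B where "B > 0" and B: "\<And>H H' G. norm H \<le> C \<Longrightarrow> norm H' \<le> C \<Longrightarrow> c \<le> \<bar>delta H\<bar> \<Longrightarrow>
      norm (system_A_rhs H H' G) \<le> B * norm G"
    by (rule system_A_rhs_linear_bound[OF \<open>c > 0\<close>]) blast
  let ?f = "\<lambda>t. system_A_rhs (h t) (ddt a b h t)"
  have "norm (G1 t - G2 t) \<le> 2 * (norm (G1 a - G2 a) + 0 * (b - a)) * exp (2 * B * (b - a))"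
  proof (rule gronwall_bound[of a b B 0 "\<lambda>t. G1 t - G2 t" "\<lambda>t. ?f t (G1 t - G2 t)"])
    show "((\<lambda>t. G1 t - G2 t) has_vector_derivative ?f t (G1 t - G2 t)) (at t within {a..b})"
      if "t \<in> {a..b}" for t
      using assms(4,5) that unfolding solves_system_A_def linear_diff[OF linear_system_A_rhs]
      by (intro has_vector_derivative_diff) auto
    show "norm (?f t (G1 t - G2 t)) \<le> B * norm (G1 t - G2 t) + 0" if "t \<in> {a..b}" for t
      using B h that by (simp add: nondegenerate_def)
  qed (use assms \<open>B > 0\<close> in auto)
  then show ?thesis using assms(6) by simp
qed

lemma system_A_exists:
  assumes "a < b" "h \<in> Omega1 a b" "general_position a b h"
  obtains G where "solves_system_A a b h G" "G a = G0"
proof -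
  obtain C c where "c > 0" and h: "h \<in> nondegenerate a b C c"
    by (rule general_position_imp_nondegenerate[OF assms(1-3)])
  obtain B where "B > 0" and B: "\<And>H H' G. norm H \<le> C \<Longrightarrow> norm H' \<le> C \<Longrightarrow> c \<le> \<bar>delta H\<bar> \<Longrightarrow>
      norm (system_A_rhs H H' G) \<le> B * norm G"
    by (rule system_A_rhs_linear_bound[OF \<open>c > 0\<close>]) blast
  let ?f = "\<lambda>t. system_A_rhs (h t) (ddt a b h t)"
  obtain G where "G a = G0" "\<And>t. t \<in> {a..b} \<Longrightarrow> (G has_vector_derivative ?f t (G t)) (at t within {a..b})"
  proof (rule picard_forward[of a b B UNIV G0 ?f])
    show "continuous_on {a..b} (\<lambda>t. ?f t (x t))" if "continuous_on {a..b} x" for x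
      using continuous_along_curve[OF system_A_rhs_bounded_lipschitz
          Omega1_continuous[OF assms(2)] that] assms(3)
      by (simp add: general_position_def)
    show "norm (?f t x - ?f t y) \<le> B * norm (x - y)" if "t \<in> {a..b}" for t x y
      using B h that by (simp add: nondegenerate_def flip: linear_diff[OF linear_system_A_rhs])
  qed (use assms \<open>B > 0\<close> in auto)
  then have "solves_system_A a b h G" unfolding solves_system_A_def by blast
  then show ?thesis using \<open>G a = G0\<close> by (rule that)
qed

lemma G_plus_props:
  assumes "a < b" "h \<in> Omega1 a b" "general_position a b h"
  shows "solves_system_A a b h (G_plus a b h)" "G_plus a b h a = G_initial (h a)"
proof -
  let ?P = "\<lambda>G. G \<in> extensional {a..b} \<and> solves_system_A a b h G \<and>
        (\<forall>i j. G a $ i $ j = (if (i, j) = (3, 2) then delta (h a) else 0))"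
  have init: "(\<forall>i j. G a $ i $ j = (if (i, j) = (3, 2) then delta (h a) else 0))
      \<longleftrightarrow> G a = G_initial (h a)" for G :: "real \<Rightarrow> real^3^3"
    by (simp add: G_initial_def vec_eq_iff)
  have "\<exists>!G. ?P G"
  proof (rule ex_ex1I)
    obtain G where G: "solves_system_A a b h G" "G a = G_initial (h a)"
      by (rule system_A_exists[OF assms])
    have "solves_system_A a b h (restrict G {a..b})"
      unfolding solves_system_A_def
    proof
      fix t assume t: "t \<in> {a..b}"
      have "(G has_vector_derivative system_A_rhs (h t) (ddt a b h t) (G t)) (at t within {a..b})"
        using G(1) t by (simp add: solves_system_A_def)
      then have "(restrict G {a..b} has_vector_derivative system_A_rhs (h t) (ddt a b h t) (G t))
          (at t within {a..b})"
        by (rule has_vector_derivative_transform[OF t, rotated]) simp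
      then show "(restrict G {a..b} has_vector_derivative
          system_A_rhs (h t) (ddt a b h t) (restrict G {a..b} t)) (at t within {a..b})"
        using t by simp
    qed
    then have "?P (restrict G {a..b})"
      unfolding init using G(2) assms(1) by simp
    then show "\<exists>G. ?P G" by (rule exI[of ?P])
  next
    fix G1 G2 assume "?P G1" "?P G2"
    then show "G1 = G2"
      unfolding init using system_A_unique[OF assms] by (intro extensionalityI[of G1 "{a..b}"]) auto
  qed
  from theI'[OF this] have "?P (G_plus a b h)" unfolding G_plus_def .
  then show "solves_system_A a b h (G_plus a b h)" "G_plus a b h a = G_initial (h a)"
    unfolding init by blast+
qed

section \<open>The vector field on tuples of continuously differentiable functions\<close>

lemma V_plus_eq_V_field:
  "t \<in> {a..b} \<Longrightarrow> V_plus a b lam h t = V_field (h t) (G_plus a b h t)"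
  by (simp add: V_plus_def vec_eq_iff V_field_nth Let_def)

lemma V_plus_has_vector_derivative:
  assumes "a < b" "h \<in> Omega1 a b" "general_position a b h" "t \<in> {a..b}"
  shows "(V_plus a b lam h has_vector_derivative
    V_field' (h t) (ddt a b h t) (G_plus a b h t) (system_A_rhs (h t) (ddt a b h t) (G_plus a b h t)))
    (at t within {a..b})"
proof (rule has_vector_derivative_transform[OF assms(4) V_plus_eq_V_field])
  show "((\<lambda>t. V_field (h t) (G_plus a b h t)) has_vector_derivative
    V_field' (h t) (ddt a b h t) (G_plus a b h t) (system_A_rhs (h t) (ddt a b h t) (G_plus a b h t)))
    (at t within {a..b})"
    using G_plus_props(1)[OF assms(1-3)] assms(3,4)
    by (intro V_field_has_vector_derivative Omega1_has_vector_derivative assms)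
      (auto simp: solves_system_A_def general_position_def)
qed

lemma V_plus_Omega1:
  assumes "a < b" "h \<in> Omega1 a b" "general_position a b h"
  shows "V_plus a b lam h \<in> Omega1 a b"
proof (rule Omega1I[OF assms(1) _ _ V_plus_has_vector_derivative[OF assms]])
  show "V_plus a b lam h \<in> extensional {a..b}" by (simp add: V_plus_def)
  have G: "continuous_on {a..b} (G_plus a b h)"
    using G_plus_props(1)[OF assms] has_vector_derivative_continuous
    unfolding solves_system_A_def continuous_on_eq_continuous_within by blast
  show "continuous_on {a..b} (\<lambda>t. V_field' (h t) (ddt a b h t) (G_plus a b h t)
      (system_A_rhs (h t) (ddt a b h t) (G_plus a b h t)))"
    using continuous_along_curve[OF V_field_bounded_lipschitz(2) Omega1_continuous[OF assms(2)] G]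
      assms(3) by (simp add: general_position_def)
qed

text \<open>
  The initial matrix of System A has only its third row different from zero. This is the reason why
  the flow leaves \<open>h\<^sub>1\<^sub>2(a)\<close>, \<open>h\<^sub>1\<^sub>3(a)\<close> and \<open>h\<^sub>2\<^sub>3(a)\<close> unchanged and hence stays in \<open>Omega1_tilde\<close>.
\<close>

lemma V_plus_initial_row:
  assumes "a < b" "h \<in> Omega1 a b" "general_position a b h" "l \<noteq> 3"
  shows "V_plus a b lam h a $ l = 0"
  using assms by (simp add: V_plus_eq_V_field G_plus_props(2) V_field_def G_initial_def)

text \<open>
  The Lipschitz estimate in the \<open>C\<^sup>1\<close> norm that carries the theorem. Gronwall's inequality is used
  twice: for one solution of System A, to see that all data \<open>(h, h', G)\<close> lie in a fixed compact phase
  set, and for the difference of two solutions, which satisfies a linear differential inequality with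
  a multiple of the distance \<open>d\<close> of the tuples as inhomogeneous term.
\<close>

lemma V_plus_lipschitz:
  assumes "a < b" "c > 0"
  obtains L where "L > 0"
    "\<And>lam h1 h2 d t. h1 \<in> nondegenerate a b C c \<Longrightarrow> h2 \<in> nondegenerate a b C c \<Longrightarrow>
      (\<And>s. s \<in> {a..b} \<Longrightarrow> norm (h1 s - h2 s) \<le> d \<and> norm (ddt a b h1 s - ddt a b h2 s) \<le> d) \<Longrightarrow>
      t \<in> {a..b} \<Longrightarrow>
      norm (V_plus a b lam h1 t - V_plus a b lam h2 t) \<le> L * d \<and>
      norm (ddt a b (V_plus a b lam h1) t - ddt a b (V_plus a b lam h2) t) \<le> L * d"
proof -
  define N where "N = norm (G_initial (mat 1))"
  have G_init: "G_initial H = delta H *\<^sub>R G_initial (mat 1)" for H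
    by (simp add: G_initial_def vec_eq_iff delta_eq_det)
  have "bounded_lipschitz (cball 0 C) delta"
    unfolding delta_def by (intro bounded_lipschitz_intros bounded_lipschitz_self bounded_cball)
  then obtain D where "D > 0" and D: "\<And>H. norm H \<le> C \<Longrightarrow> \<bar>delta H\<bar> \<le> D"
    "\<And>H1 H2. norm H1 \<le> C \<Longrightarrow> norm H2 \<le> C \<Longrightarrow> \<bar>delta H1 - delta H2\<bar> \<le> D * norm (H1 - H2)"
    by (rule bounded_lipschitzE) (simp add: dist_norm)
  obtain B where "B > 0" and B: "\<And>H H' G. norm H \<le> C \<Longrightarrow> norm H' \<le> C \<Longrightarrow> c \<le> \<bar>delta H\<bar> \<Longrightarrow>
      norm (system_A_rhs H H' G) \<le> B * norm G"
    by (rule system_A_rhs_linear_bound[OF \<open>c > 0\<close>]) blast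
  \<comment> \<open>The bound that Gronwall's inequality, with inhomogeneous term 0, gives for the solutions of System A.\<close>
  define R where "R = 2 * (D * N + 0 * (b - a)) * exp (2 * B * (b - a))"
  define P where "P = phase (max C R) c"
  note lip_P = bounded_lipschitz_on_phase[OF assms(2), of "max C R", folded P_def]
  obtain M1 where M1: "M1 > 0" "\<And>x y. x \<in> P \<Longrightarrow> y \<in> P \<Longrightarrow>
      norm (system_A_rhs (fst x) (fst (snd x)) (snd (snd x))
        - system_A_rhs (fst y) (fst (snd y)) (snd (snd y))) \<le> M1 * dist x y"
    by (rule bounded_lipschitzE[OF lip_P(1)]) (rule that)
  obtain M2 where M2: "M2 > 0" "\<And>x y. x \<in> P \<Longrightarrow> y \<in> P \<Longrightarrow>
      norm (V_field (fst x) (snd (snd x)) - V_field (fst y) (snd (snd y))) \<le> M2 * dist x y"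
    by (rule bounded_lipschitzE[OF lip_P(2)]) (rule that)
  obtain M3 where M3: "M3 > 0" "\<And>x y. x \<in> P \<Longrightarrow> y \<in> P \<Longrightarrow>
      norm (V_field' (fst x) (fst (snd x)) (snd (snd x)) (system_A_rhs (fst x) (fst (snd x)) (snd (snd x)))
        - V_field' (fst y) (fst (snd y)) (snd (snd y)) (system_A_rhs (fst y) (fst (snd y)) (snd (snd y))))
      \<le> M3 * dist x y"
    by (rule bounded_lipschitzE[OF lip_P(3)]) (rule that)
  \<comment> \<open>The points (h, h', G) of the two tuples are at distance at most K * d: 2 accounts for h and h', the rest for G.\<close>
  define K where "K = 2 + 2 * (D * N + M1 * 2 * (b - a)) * exp (2 * M1 * (b - a))"
  have N0: "N \<ge> 0" by (simp add: N_def)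
  have K0: "K > 0" using N0 \<open>D > 0\<close> M1(1) assms(1) unfolding K_def
    by (intro add_pos_nonneg mult_nonneg_nonneg add_nonneg_nonneg) auto
  show ?thesis
  proof
    show "(M2 + M3) * K > 0" using M2(1) M3(1) K0 by simp
    fix lam h1 h2 d t
    assume h1: "h1 \<in> nondegenerate a b C c" and h2: "h2 \<in> nondegenerate a b C c"
      and d: "\<And>s. s \<in> {a..b} \<Longrightarrow> norm (h1 s - h2 s) \<le> d \<and> norm (ddt a b h1 s - ddt a b h2 s) \<le> d"
      and t: "t \<in> {a..b}"
    have a: "a \<in> {a..b}" using assms(1) by simp
    have d0: "d \<ge> 0" using d[OF a] norm_ge_zero order_trans by blast
    have nd: "h \<in> Omega1 a b" "general_position a b h"
      if "h \<in> nondegenerate a b C c" for h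
      using that assms(2) by (auto simp: nondegenerate_def general_position_def)
    define p where "p h s = (h s, ddt a b h s, G_plus a b h s)" for h s
    let ?f = "\<lambda>h s. system_A_rhs (h s) (ddt a b h s) (G_plus a b h s)"
    have G: "(G_plus a b h has_vector_derivative ?f h s) (at s within {a..b})"
      if "h \<in> nondegenerate a b C c" "s \<in> {a..b}" for h s
      using G_plus_props(1)[OF assms(1) nd[OF that(1)]] that(2) by (simp add: solves_system_A_def)
    have G_a: "G_plus a b h a = G_initial (h a)" if "h \<in> nondegenerate a b C c" for h
      by (rule G_plus_props(2)[OF assms(1) nd[OF that]])
    have p_P: "p h s \<in> P" if h: "h \<in> nondegenerate a b C c" and s: "s \<in> {a..b}" for h s
    proof -
      have "norm (G_plus a b h s) \<le> 2 * (norm (G_plus a b h a) + 0 * (b - a)) * exp (2 * B * (b - a))"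
        by (rule gronwall_bound[OF _ _ _ G[OF h] _ s])
          (use h B \<open>B > 0\<close> assms(1) in \<open>auto simp: nondegenerate_def\<close>)
      also have "norm (G_plus a b h a) \<le> D * N"
        using D(1)[of "h a"] h a N0
        by (auto simp: G_a[OF h] G_init[of "h a"] N_def nondegenerate_def intro!: mult_right_mono)
      finally have "norm (G_plus a b h s) \<le> R" by (simp add: R_def)
      then show ?thesis using h s by (auto simp: P_def phase_def p_def nondegenerate_def le_max_iff_disj)
    qed
    have dist_p: "dist (p h1 s) (p h2 s) \<le> 2 * d + norm (G_plus a b h1 s - G_plus a b h2 s)"
      if "s \<in> {a..b}" for s
      using d[OF that] norm_Pair_le[of "h1 s - h2 s"
          "(ddt a b h1 s - ddt a b h2 s, G_plus a b h1 s - G_plus a b h2 s)"]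
        norm_Pair_le[of "ddt a b h1 s - ddt a b h2 s" "G_plus a b h1 s - G_plus a b h2 s"]
      by (simp add: p_def dist_norm)
    have "norm (G_plus a b h1 t - G_plus a b h2 t)
        \<le> 2 * (norm (G_plus a b h1 a - G_plus a b h2 a) + (M1 * (2 * d)) * (b - a)) * exp (2 * M1 * (b - a))"
    proof (rule gronwall_bound[OF _ M1(1) _ has_vector_derivative_diff[OF G[OF h1] G[OF h2]] _ t])
      show "norm (?f h1 s - ?f h2 s) \<le> M1 * norm (G_plus a b h1 s - G_plus a b h2 s) + M1 * (2 * d)"
        if "s \<in> {a..b}" for s
      proof -
        have "norm (?f h1 s - ?f h2 s) \<le> M1 * dist (p h1 s) (p h2 s)"
          using M1(2)[OF p_P[OF h1 that] p_P[OF h2 that]] by (simp add: p_def)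
        also have "\<dots> \<le> M1 * (2 * d + norm (G_plus a b h1 s - G_plus a b h2 s))"
          using dist_p[OF that] M1(1) by simp
        finally show ?thesis by (simp add: algebra_simps)
      qed
    qed (use assms(1) M1(1) d0 in auto)
    also have "norm (G_plus a b h1 a - G_plus a b h2 a) \<le> (D * d) * N"
    proof -
      have "\<bar>delta (h1 a) - delta (h2 a)\<bar> \<le> D * norm (h1 a - h2 a)"
        using D(2) h1 h2 a by (simp add: nondegenerate_def)
      also have "\<dots> \<le> D * d" using d[OF a] \<open>D > 0\<close> by simp
      finally show ?thesis
        using N0 by (auto simp: G_a h1 h2 G_init[of "h1 a"] G_init[of "h2 a"] N_def
            intro!: mult_right_mono simp flip: scaleR_diff_left)
    qed
    finally have "norm (G_plus a b h1 t - G_plus a b h2 t) \<le> (K - 2) * d"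
      by (simp add: K_def algebra_simps)
    with dist_p[OF t] have p_t: "dist (p h1 t) (p h2 t) \<le> K * d" by (simp add: algebra_simps)
    have "norm (V_plus a b lam h1 t - V_plus a b lam h2 t) \<le> M2 * dist (p h1 t) (p h2 t)"
      using M2(2)[OF p_P[OF h1 t] p_P[OF h2 t]] by (simp add: p_def V_plus_eq_V_field[OF t])
    also have "\<dots> \<le> (M2 + M3) * (K * d)"
      using p_t M2(1) M3(1) by (intro mult_mono) auto
    finally have 1: "norm (V_plus a b lam h1 t - V_plus a b lam h2 t) \<le> (M2 + M3) * K * d"
      by (simp add: mult.assoc)
    have ddt: "ddt a b (V_plus a b lam h) t = V_field' (h t) (ddt a b h t) (G_plus a b h t) (?f h t)"
      if "h \<in> nondegenerate a b C c" for h
      by (rule ddt_eqI[OF assms(1) t V_plus_has_vector_derivative[OF assms(1) nd[OF that] t]])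
    have "norm (ddt a b (V_plus a b lam h1) t - ddt a b (V_plus a b lam h2) t) \<le> M3 * dist (p h1 t) (p h2 t)"
      using M3(2)[OF p_P[OF h1 t] p_P[OF h2 t]] by (simp add: p_def ddt h1 h2)
    also have "\<dots> \<le> (M2 + M3) * (K * d)"
      using p_t M2(1) M3(1) by (intro mult_mono) auto
    finally have 2: "norm (ddt a b (V_plus a b lam h1) t - ddt a b (V_plus a b lam h2) t) \<le> (M2 + M3) * K * d"
      by (simp add: mult.assoc)
    show "norm (V_plus a b lam h1 t - V_plus a b lam h2 t) \<le> (M2 + M3) * K * d \<and>
      norm (ddt a b (V_plus a b lam h1) t - ddt a b (V_plus a b lam h2) t) \<le> (M2 + M3) * K * d"
      using 1 2 ..
  qed
qed

section \<open>The Banach space of continuously differentiable tuples\<close>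

lemma has_vector_derivative_iff_quotient:
  fixes f :: "real \<Rightarrow> 'a::real_normed_vector"
  shows "(f has_vector_derivative D) (at x within S) \<longleftrightarrow>
    ((\<lambda>y. norm ((f y - f x) /\<^sub>R (y - x) - D)) \<longlongrightarrow> 0) (at x within S)"
proof -
  have eq: "norm ((1 / norm (y - x)) *\<^sub>R (f y - (f x + (y - x) *\<^sub>R D)))
      = norm ((f y - f x) /\<^sub>R (y - x) - D)" if "y \<noteq> x" for y
  proof -
    have "(f y - f x) /\<^sub>R (y - x) - D = (1 / (y - x)) *\<^sub>R (f y - (f x + (y - x) *\<^sub>R D))"
      using that by (simp add: scaleR_diff_right scaleR_add_right divide_inverse)
    then show ?thesis by simp
  qed
  have "(f has_vector_derivative D) (at x within S) \<longleftrightarrow>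
    ((\<lambda>y. norm ((1 / norm (y - x)) *\<^sub>R (f y - (f x + (y - x) *\<^sub>R D)))) \<longlongrightarrow> 0) (at x within S)"
    unfolding has_vector_derivative_def has_derivative_within tendsto_norm_zero_iff
    by (simp add: bounded_linear_scaleR_left)
  also have "\<dots> \<longleftrightarrow> ((\<lambda>y. norm ((f y - f x) /\<^sub>R (y - x) - D)) \<longlongrightarrow> 0) (at x within S)"
  proof (rule tendsto_cong)
    show "\<forall>\<^sub>F y in at x within S. norm ((1 / norm (y - x)) *\<^sub>R (f y - (f x + (y - x) *\<^sub>R D)))
        = norm ((f y - f x) /\<^sub>R (y - x) - D)"
      unfolding eventually_at_filter using eq by (intro always_eventually) blast
  qed
  finally show ?thesis .
qed

text \<open>
  A \<open>C\<^sup>1\<close> function is determined by its value at \<open>a\<close> and its derivative, and every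
  value can be combined with every continuous derivative, so completeness of the space of pairs
  replaces a completeness proof for the \<open>C\<^sup>1\<close> norm. The derivative is extended
  constantly beyond \<open>[a,b]\<close> to become a bounded continuous function on the line.
\<close>

definition C1_pair :: "real \<Rightarrow> real \<Rightarrow> (real \<Rightarrow> real^3^3) \<Rightarrow> (real^3^3) \<times> (real \<Rightarrow>\<^sub>C (real^3^3))" where
  "C1_pair a b h = (h a, Bcontfun (\<lambda>t. ddt a b h (clamp a b t)))"

text \<open>
  On \<open>Omega1\<close>, a left inverse of \<open>C1_pair\<close>. It ignores the second component outside \<open>[a,b]\<close>, so it is
  not injective.
\<close>

definition C1_curve :: "real \<Rightarrow> real \<Rightarrow> (real^3^3) \<times> (real \<Rightarrow>\<^sub>C (real^3^3)) \<Rightarrow> real \<Rightarrow> real^3^3" where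
  "C1_curve a b x = (\<lambda>t\<in>{a..b}. fst x + integral {a..t} (apply_bcontfun (snd x)))"

lemma fst_C1_pair [simp]: "fst (C1_pair a b h) = h a"
  by (simp add: C1_pair_def)

lemma snd_C1_pair:
  assumes "continuous_on {a..b} (ddt a b h)"
  shows "apply_bcontfun (snd (C1_pair a b h)) t = ddt a b h (clamp a b t)"
proof -
  obtain g where g: "\<And>x. apply_bcontfun g x = ddt a b h (clamp a b x)"
    by (rule continuous_on_cbox_bcontfunE[of a b "ddt a b h"]) (use assms in auto)
  then have "(\<lambda>x. ddt a b h (clamp a b x)) = apply_bcontfun g" by auto
  then have "Bcontfun (\<lambda>x. ddt a b h (clamp a b x)) = g" by (simp only: apply_bcontfun_inverse)
  then show ?thesis using g by (simp add: C1_pair_def)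
qed

lemma clamp_Icc: "a \<le> b \<Longrightarrow> clamp a b t \<in> {a..b}" "t \<in> {a..b} \<Longrightarrow> clamp a b t = t" for a b t :: real
  using clamp_in_interval[of a b t] clamp_cancel_cbox[of t a b] by auto

lemma C1_curve_has_vector_derivative:
  assumes "t \<in> {a..b}"
  shows "(C1_curve a b x has_vector_derivative apply_bcontfun (snd x) t) (at t within {a..b})"
proof (rule has_vector_derivative_transform[OF assms])
  show "C1_curve a b x s = fst x + integral {a..s} (apply_bcontfun (snd x))" if "s \<in> {a..b}" for s
    using that by (simp add: C1_curve_def)
  have "((\<lambda>u. integral {a..u} (apply_bcontfun (snd x))) has_vector_derivative apply_bcontfun (snd x) t)
      (at t within {a..b})"
    by (rule integral_has_vector_derivative[OF continuous_on_apply_bcontfun assms])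
  from has_vector_derivative_add[OF has_vector_derivative_const this]
  show "((\<lambda>s. fst x + integral {a..s} (apply_bcontfun (snd x))) has_vector_derivative
      apply_bcontfun (snd x) t) (at t within {a..b})"
    by simp
qed

lemma ddt_C1_curve: "a < b \<Longrightarrow> t \<in> {a..b} \<Longrightarrow> ddt a b (C1_curve a b x) t = apply_bcontfun (snd x) t"
  by (intro ddt_eqI C1_curve_has_vector_derivative)

lemma C1_curve_Omega1: "a < b \<Longrightarrow> C1_curve a b x \<in> Omega1 a b"
  by (rule Omega1I[OF _ _ continuous_on_apply_bcontfun C1_curve_has_vector_derivative])
    (auto simp: C1_curve_def)

lemma C1_curve_start: "a \<le> b \<Longrightarrow> C1_curve a b x a = fst x"
  by (simp add: C1_curve_def)

lemma C1_curve_pair: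
  assumes "a < b" "h \<in> Omega1 a b"
  shows "C1_curve a b (C1_pair a b h) = h"
proof (rule extensionalityI[of _ "{a..b}"])
  show "C1_curve a b (C1_pair a b h) \<in> extensional {a..b}" by (simp add: C1_curve_def)
  show "h \<in> extensional {a..b}" using assms(2) by (simp add: Omega1_def)
  fix t assume t: "t \<in> {a..b}"
  have "(ddt a b h has_integral (h t - h a)) {a..t}"
  proof (rule fundamental_theorem_of_calculus)
    show "(h has_vector_derivative ddt a b h s) (at s within {a..t})" if "s \<in> {a..t}" for s
      by (rule has_vector_derivative_within_subset[OF Omega1_has_vector_derivative[OF assms(2)]])
        (use that t in auto)
  qed (use t in simp)
  moreover have "integral {a..t} (apply_bcontfun (snd (C1_pair a b h))) = integral {a..t} (ddt a b h)"
    using t by (intro integral_cong)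
      (auto simp: snd_C1_pair[OF Omega1_continuous(2)[OF assms(2)]] clamp_Icc)
  ultimately show "C1_curve a b (C1_pair a b h) t = h t"
    using t by (simp add: C1_curve_def integral_unique)
qed

lemma norm_fst_snd_le: "norm (fst x) \<le> norm x" "norm (snd x) \<le> norm x"
  by (metis norm_fst_le norm_snd_le prod.collapse)+

lemma norm_le_norm_C1_pair:
  assumes "a < b" "t \<in> {a..b}"
    and k: "\<And>s. s \<in> {a..b} \<Longrightarrow> (k has_vector_derivative apply_bcontfun (snd x) s) (at s within {a..b})"
    and "k a = fst x"
  shows "norm (k t) \<le> (1 + (b - a)) * norm x"
proof -
  have snd: "norm (apply_bcontfun (snd x) s) \<le> norm x" for s
    using norm_bounded[of "snd x" s] norm_fst_snd_le(2)[of x] by simp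
  have "norm (k t - k a) \<le> norm x * t - norm x * a"
  proof (rule norm_increment_le)
    show "(k has_vector_derivative apply_bcontfun (snd x) s) (at s within {a..t})" if "s \<in> {a..t}" for s
      by (rule has_vector_derivative_within_subset[OF k]) (use that assms(2) in auto)
    show "((\<lambda>s. norm x * s) has_vector_derivative norm x) (at s within {a..t})" for s
      by (auto intro!: derivative_eq_intros simp flip: has_real_derivative_iff_has_vector_derivative)
  qed (use assms(2) snd in auto)
  moreover have "norm (k a) \<le> norm x" using assms(4) norm_fst_snd_le(1)[of x] by simp
  moreover have "norm x * t - norm x * a \<le> norm x * (b - a)"
    using assms(2) by (simp add: right_diff_distrib mult_left_mono)
  ultimately show ?thesis
    using norm_triangle_sub[of "k t" "k a"] by (simp add: algebra_simps)
qed

lemma norm_C1_pair_le: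
  fixes x :: "(real^3^3) \<times> (real \<Rightarrow>\<^sub>C (real^3^3))"
  assumes "norm (fst x) \<le> d" "\<And>t. norm (apply_bcontfun (snd x) t) \<le> d"
  shows "norm x \<le> 2 * d"
  using norm_Pair_le[of "fst x" "snd x"] norm_bound[of "snd x" d] assms by simp

lemma norm_le_entries:
  fixes A :: "real^3^3"
  assumes "\<And>i j. \<bar>A $ i $ j\<bar> \<le> m"
  shows "norm A \<le> 9 * m"
proof -
  have "norm A \<le> (\<Sum>i\<in>UNIV. norm (A $ i))"
    unfolding norm_vec_def[of A] by (rule L2_set_le_sum) simp
  also have "\<dots> \<le> (\<Sum>i\<in>(UNIV::3 set). \<Sum>j\<in>(UNIV::3 set). \<bar>A $ i $ j\<bar>)"
    by (intro sum_mono norm_le_l1_cart)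
  also have "\<dots> \<le> (\<Sum>i\<in>(UNIV::3 set). \<Sum>j\<in>(UNIV::3 set). m)"
    by (intro sum_mono assms)
  finally show ?thesis by simp
qed

text \<open>
  Both directions of the equivalence of \<open>Omega1_norm\<close> with the sum of the supremum norms of a
  function and its derivative. They are stated for functions that are not elements of \<open>Omega1\<close>
  because the difference quotients of curves in \<open>Omega1\<close> are not extensional.
\<close>

lemma
  fixes k :: "real \<Rightarrow> real^3^3"
  assumes "a < b" and k: "\<And>t. t \<in> {a..b} \<Longrightarrow> (k has_vector_derivative k' t) (at t within {a..b})"
    and k': "continuous_on {a..b} k'"
  shows norm_le_Omega1_norm: "t \<in> {a..b} \<Longrightarrow> norm (k t) \<le> 9 * Omega1_norm a b k"
    "t \<in> {a..b} \<Longrightarrow> norm (k' t) \<le> 9 * Omega1_norm a b k"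
    and Omega1_norm_le: "(\<And>t. t \<in> {a..b} \<Longrightarrow> norm (k t) \<le> M \<and> norm (k' t) \<le> M) \<Longrightarrow>
      Omega1_norm a b k \<le> M"
proof -
  have ddt: "ddt a b k t = k' t" if "t \<in> {a..b}" for t
    by (rule ddt_eqI[OF assms(1) that k[OF that]])
  define N where "N = (\<lambda>(i, j). max (SUP t\<in>{a..b}. \<bar>k t $ i $ j\<bar>) (SUP t\<in>{a..b}. \<bar>k' t $ i $ j\<bar>))"
  have "(SUP t\<in>{a..b}. \<bar>ddt a b k t $ i $ j\<bar>) = (SUP t\<in>{a..b}. \<bar>k' t $ i $ j\<bar>)" for i j
    by (intro SUP_cong) (simp_all add: ddt)
  then have norm_eq: "Omega1_norm a b k = Max (N ` UNIV)"
    by (simp add: Omega1_norm_def N_def)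
  have cont_k: "continuous_on {a..b} k"
    using k continuous_on_eq_continuous_within has_vector_derivative_continuous by blast
  have bdd: "bdd_above ((\<lambda>t. \<bar>g t $ i $ j\<bar>) ` {a..b})" if "continuous_on {a..b} g"
    for g :: "real \<Rightarrow> real^3^3" and i j
    by (intro bounded_imp_bdd_above compact_imp_bounded compact_continuous_image continuous_intros
        that compact_Icc)
  have entry: "\<bar>k t $ i $ j\<bar> \<le> Omega1_norm a b k \<and> \<bar>k' t $ i $ j\<bar> \<le> Omega1_norm a b k"
    if "t \<in> {a..b}" for t i j
  proof -
    have "N (i, j) \<le> Omega1_norm a b k" unfolding norm_eq by (intro Max_ge) auto
    moreover have "\<bar>k t $ i $ j\<bar> \<le> N (i, j)"
      unfolding N_def case_prod_conv by (intro max.coboundedI1 cSUP_upper that bdd cont_k)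
    moreover have "\<bar>k' t $ i $ j\<bar> \<le> N (i, j)"
      unfolding N_def case_prod_conv by (intro max.coboundedI2 cSUP_upper that bdd k')
    ultimately show ?thesis by linarith
  qed
  show "norm (k t) \<le> 9 * Omega1_norm a b k" "norm (k' t) \<le> 9 * Omega1_norm a b k" if "t \<in> {a..b}"
    using entry[OF that] by (auto intro!: norm_le_entries)
  assume M: "\<And>t. t \<in> {a..b} \<Longrightarrow> norm (k t) \<le> M \<and> norm (k' t) \<le> M"
  have entry_le: "\<bar>A $ i $ j\<bar> \<le> norm A" for A :: "real^3^3" and i j
    using component_le_norm_cart[of "A $ i" j] Finite_Cartesian_Product.norm_nth_le[of A i] by linarith
  have "N (i, j) \<le> M" for i j
    using M assms(1) unfolding N_def
    by (auto intro!: cSUP_least intro: order_trans[OF entry_le])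
  then show "Omega1_norm a b k \<le> M"
    unfolding norm_eq by (intro Max.boundedI) auto
qed

text \<open>
  Differentiability of a curve in the norm of \<open>Omega1\<close> is differentiability of its coordinates:
  \<open>C1_pair\<close> is linear, and the two norms of a difference quotient bound each other.
\<close>

lemma has_Omega1_derivative_iff:
  assumes ab: "a < b" and \<gamma>: "\<And>\<mu>. \<mu> \<in> S \<Longrightarrow> \<gamma> \<mu> \<in> Omega1 a b" and lam: "lam \<in> S"
    and D: "D \<in> Omega1 a b"
  shows "has_Omega1_derivative a b \<gamma> D lam S \<longleftrightarrow>
    ((\<lambda>\<mu>. C1_pair a b (\<gamma> \<mu>)) has_vector_derivative C1_pair a b D) (at lam within S)"
proof -
  define q where "q \<mu> t = (\<gamma> \<mu> t - \<gamma> lam t) /\<^sub>R (\<mu> - lam) - D t" for \<mu> t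
  define q' where "q' \<mu> t = (ddt a b (\<gamma> \<mu>) t - ddt a b (\<gamma> lam) t) /\<^sub>R (\<mu> - lam) - ddt a b D t" for \<mu> t
  define x where "x \<mu> = (C1_pair a b (\<gamma> \<mu>) - C1_pair a b (\<gamma> lam)) /\<^sub>R (\<mu> - lam) - C1_pair a b D" for \<mu>
  note deriv = Omega1_has_vector_derivative and cont = Omega1_continuous(2)
  have q: "(q \<mu> has_vector_derivative q' \<mu> t) (at t within {a..b})" if "\<mu> \<in> S" "t \<in> {a..b}" for \<mu> t
    unfolding q_def q'_def
    by (intro has_vector_derivative_diff bounded_linear.has_vector_derivative[OF bounded_linear_scaleR_right]
        deriv \<gamma> lam D that)
  have q'_cont: "continuous_on {a..b} (q' \<mu>)" if "\<mu> \<in> S" for \<mu>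
    unfolding q'_def by (intro continuous_intros cont \<gamma> lam D that)
  have fst_x: "fst (x \<mu>) = q \<mu> a" for \<mu> by (simp add: x_def q_def)
  have snd_x: "apply_bcontfun (snd (x \<mu>)) t = q' \<mu> (clamp a b t)" if "\<mu> \<in> S" for \<mu> t
    by (simp add: x_def q'_def snd_C1_pair cont \<gamma> lam D that)
  have le1: "norm (x \<mu>) \<le> 18 * Omega1_norm a b (q \<mu>)" if "\<mu> \<in> S" for \<mu>
  proof -
    have "norm (x \<mu>) \<le> 2 * (9 * Omega1_norm a b (q \<mu>))"
      using ab clamp_Icc(1)[of a b] by (intro norm_C1_pair_le)
        (auto simp: fst_x snd_x that intro!: norm_le_Omega1_norm[OF ab q q'_cont] that)
    then show ?thesis by simp
  qed
  have le2: "Omega1_norm a b (q \<mu>) \<le> (1 + (b - a)) * norm (x \<mu>)" if "\<mu> \<in> S" for \<mu>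
  proof (rule Omega1_norm_le[OF ab q[OF that] q'_cont[OF that]])
    fix t assume t: "t \<in> {a..b}"
    have "norm (q \<mu> t) \<le> (1 + (b - a)) * norm (x \<mu>)"
      using q[OF that] by (intro norm_le_norm_C1_pair ab t) (auto simp: fst_x snd_x[OF that] clamp_Icc)
    moreover have "norm (q' \<mu> t) \<le> norm (x \<mu>)"
      using norm_bounded[of "snd (x \<mu>)" t] norm_fst_snd_le(2)[of "x \<mu>"] snd_x[OF that, of t] t
      by (simp add: clamp_Icc)
    moreover have "norm (x \<mu>) \<le> (1 + (b - a)) * norm (x \<mu>)"
      using ab by (simp add: mult_le_cancel_right1)
    ultimately show "norm (q \<mu> t) \<le> (1 + (b - a)) * norm (x \<mu>) \<and> norm (q' \<mu> t) \<le> (1 + (b - a)) * norm (x \<mu>)"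
      by linarith
  qed
  have nonneg: "Omega1_norm a b (q \<mu>) \<ge> 0" if "\<mu> \<in> S" for \<mu>
    using le1[OF that] norm_ge_zero[of "x \<mu>"] by linarith
  have in_S: "\<forall>\<^sub>F \<mu> in at lam within S. \<mu> \<in> S" by (simp add: eventually_at_filter)
  have "((\<lambda>\<mu>. Omega1_norm a b (q \<mu>)) \<longlongrightarrow> 0) (at lam within S) \<longleftrightarrow>
      ((\<lambda>\<mu>. norm (x \<mu>)) \<longlongrightarrow> 0) (at lam within S)"
  proof
    assume lim: "((\<lambda>\<mu>. Omega1_norm a b (q \<mu>)) \<longlongrightarrow> 0) (at lam within S)"
    show "((\<lambda>\<mu>. norm (x \<mu>)) \<longlongrightarrow> 0) (at lam within S)"
      by (rule tendsto_sandwich[OF _ _ tendsto_const tendsto_mult_right_zero[OF lim, of 18]])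
        (use eventually_mono[OF in_S le1] in auto)
  next
    assume lim: "((\<lambda>\<mu>. norm (x \<mu>)) \<longlongrightarrow> 0) (at lam within S)"
    show "((\<lambda>\<mu>. Omega1_norm a b (q \<mu>)) \<longlongrightarrow> 0) (at lam within S)"
      by (rule tendsto_sandwich[OF _ _ tendsto_const tendsto_mult_right_zero[OF lim, of "1 + (b - a)"]])
        (use eventually_mono[OF in_S le2] eventually_mono[OF in_S nonneg] in auto)
  qed
  then show ?thesis
    unfolding has_Omega1_derivative_def has_vector_derivative_iff_quotient q_def x_def using D by simp
qed

section \<open>Existence and uniqueness of the flow\<close>

definition pair_field :: "real \<Rightarrow> real \<Rightarrow> (real^3^3) \<times> (real \<Rightarrow>\<^sub>C (real^3^3)) \<Rightarrow> (real^3^3) \<times> (real \<Rightarrow>\<^sub>C (real^3^3))"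
  where "pair_field a b x = C1_pair a b (V_plus a b 0 (C1_curve a b x))"

lemma V_plus_autonomous: "V_plus a b lam h = V_plus a b 0 h"
  by (simp add: V_plus_def)

lemma C1_curve_diff_le:
  assumes "a < b" "t \<in> {a..b}"
  shows "norm (C1_curve a b x t - C1_curve a b y t) \<le> (1 + (b - a)) * norm (x - y)"
    and "norm (ddt a b (C1_curve a b x) t - ddt a b (C1_curve a b y) t) \<le> (1 + (b - a)) * norm (x - y)"
proof -
  have "((\<lambda>s. C1_curve a b x s - C1_curve a b y s) has_vector_derivative apply_bcontfun (snd (x - y)) s)
      (at s within {a..b})" if "s \<in> {a..b}" for s
    using has_vector_derivative_diff[OF C1_curve_has_vector_derivative[OF that]
        C1_curve_has_vector_derivative[OF that]] by simp
  then show "norm (C1_curve a b x t - C1_curve a b y t) \<le> (1 + (b - a)) * norm (x - y)"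
    using assms by (intro norm_le_norm_C1_pair) (auto simp: C1_curve_start)
  have "norm (apply_bcontfun (snd (x - y)) t) \<le> norm (x - y)"
    using norm_bounded[of "snd (x - y)" t] norm_fst_snd_le(2)[of "x - y"] by linarith
  moreover have "norm (x - y) \<le> (1 + (b - a)) * norm (x - y)"
    using assms by (simp add: mult_le_cancel_right1)
  ultimately show "norm (ddt a b (C1_curve a b x) t - ddt a b (C1_curve a b y) t)
      \<le> (1 + (b - a)) * norm (x - y)"
    using assms by (simp add: ddt_C1_curve)
qed

lemma nondegenerate_imp_general_position:
  "c > 0 \<Longrightarrow> h \<in> nondegenerate a b C c \<Longrightarrow> general_position a b h"
  by (auto simp: nondegenerate_def general_position_def)

lemma nondegenerate_mono:
  "C \<le> C' \<Longrightarrow> c' \<le> c \<Longrightarrow> nondegenerate a b C c \<subseteq> nondegenerate a b C' c'"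
  by (fastforce simp: nondegenerate_def)

lemma pair_field_lipschitz:
  assumes "a < b" "c > 0"
  obtains L where "L > 0" "\<And>x y. C1_curve a b x \<in> nondegenerate a b C c \<Longrightarrow>
    C1_curve a b y \<in> nondegenerate a b C c \<Longrightarrow> norm (pair_field a b x - pair_field a b y) \<le> L * norm (x - y)"
proof -
  obtain L where L: "L > 0"
    "\<And>lam h1 h2 d t. h1 \<in> nondegenerate a b C c \<Longrightarrow> h2 \<in> nondegenerate a b C c \<Longrightarrow>
      (\<And>s. s \<in> {a..b} \<Longrightarrow> norm (h1 s - h2 s) \<le> d \<and> norm (ddt a b h1 s - ddt a b h2 s) \<le> d) \<Longrightarrow>
      t \<in> {a..b} \<Longrightarrow>
      norm (V_plus a b lam h1 t - V_plus a b lam h2 t) \<le> L * d \<and>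
      norm (ddt a b (V_plus a b lam h1) t - ddt a b (V_plus a b lam h2) t) \<le> L * d"
    by (rule V_plus_lipschitz[OF assms, of C]) blast
  show ?thesis
  proof
    show "2 * (L * (1 + (b - a))) > 0" using L(1) assms(1) by simp
    fix x y
    assume x: "C1_curve a b x \<in> nondegenerate a b C c" and y: "C1_curve a b y \<in> nondegenerate a b C c"
    have le: "norm (V_plus a b 0 (C1_curve a b x) t - V_plus a b 0 (C1_curve a b y) t)
          \<le> L * ((1 + (b - a)) * norm (x - y)) \<and>
        norm (ddt a b (V_plus a b 0 (C1_curve a b x)) t - ddt a b (V_plus a b 0 (C1_curve a b y)) t)
          \<le> L * ((1 + (b - a)) * norm (x - y))" if "t \<in> {a..b}" for t
      by (rule L(2)[OF x y _ that]) (intro conjI C1_curve_diff_le assms(1))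
    have cont: "continuous_on {a..b} (ddt a b (V_plus a b 0 h))" if "h \<in> nondegenerate a b C c" for h
      using that nondegenerate_imp_general_position[OF assms(2) that]
      by (intro Omega1_continuous V_plus_Omega1 assms(1)) (auto simp: nondegenerate_def)
    have "norm (pair_field a b x - pair_field a b y) \<le> 2 * (L * ((1 + (b - a)) * norm (x - y)))"
      using le[of a] le[of "clamp a b _"] clamp_Icc(1)[of a b] assms(1)
      by (intro norm_C1_pair_le) (auto simp: pair_field_def snd_C1_pair cont[OF x] cont[OF y])
    then show "norm (pair_field a b x - pair_field a b y) \<le> 2 * (L * (1 + (b - a))) * norm (x - y)"
      by (simp add: mult.assoc)
  qed
qed

text \<open>
  The determinant is Lipschitz on bounded sets, so it keeps half of its lower bound under a
  \<open>C\<^sup>1\<close>-small perturbation, uniformly in time.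
\<close>

lemma nondegenerate_cball:
  assumes "a < b" "general_position a b (C1_curve a b x0)"
  obtains R C c where "R > 0" "c > 0"
    "\<And>x. x \<in> cball x0 R \<Longrightarrow> C1_curve a b x \<in> nondegenerate a b C c"
proof -
  obtain C c where c: "c > 0" and h0: "C1_curve a b x0 \<in> nondegenerate a b C c"
    by (rule general_position_imp_nondegenerate[OF assms(1) C1_curve_Omega1[OF assms(1)] assms(2)])
  define K where "K = 1 + (b - a)"
  have K: "K > 0" using assms(1) by (simp add: K_def)
  have "bounded_lipschitz (cball 0 (C + K)) delta"
    unfolding delta_def by (intro bounded_lipschitz_intros bounded_lipschitz_self bounded_cball)
  then obtain D where D: "D > 0" "\<And>H1 H2. norm H1 \<le> C + K \<Longrightarrow> norm H2 \<le> C + K \<Longrightarrow>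
      \<bar>delta H1 - delta H2\<bar> \<le> D * norm (H1 - H2)"
    by (rule bounded_lipschitzE) (simp add: dist_norm)
  define R where "R = min 1 (c / (2 * D * K))"
  have R: "R > 0" "R \<le> 1" "D * (K * R) \<le> c / 2"
  proof -
    show "R > 0" "R \<le> 1" using c D(1) K by (simp_all add: R_def)
    have "D * K * R \<le> D * K * (c / (2 * D * K))"
      using D(1) K by (intro mult_left_mono) (auto simp: R_def)
    then show "D * (K * R) \<le> c / 2" using D(1) K by (simp add: mult.assoc)
  qed
  show ?thesis
  proof
    show "R > 0" "c / 2 > 0" using R c by simp_all
    fix x assume "x \<in> cball x0 R"
    then have "K * norm (x - x0) \<le> K * R"
      using K by (simp add: dist_norm norm_minus_commute)
    moreover have "K * R \<le> K" using K R by simp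
    ultimately have d: "norm (C1_curve a b x t - C1_curve a b x0 t) \<le> K * R"
        "norm (ddt a b (C1_curve a b x) t - ddt a b (C1_curve a b x0) t) \<le> K" if "t \<in> {a..b}" for t
      using C1_curve_diff_le[OF assms(1) that, of x x0] unfolding K_def by linarith+
    show "C1_curve a b x \<in> nondegenerate a b (C + K) (c / 2)"
      unfolding nondegenerate_def
    proof (intro CollectI conjI ballI C1_curve_Omega1 assms(1))
      fix t assume t: "t \<in> {a..b}"
      have h0_t: "norm (C1_curve a b x0 t) \<le> C" "norm (ddt a b (C1_curve a b x0) t) \<le> C"
        "c \<le> \<bar>delta (C1_curve a b x0 t)\<bar>"
        using h0 t by (auto simp: nondegenerate_def)
      show C: "norm (C1_curve a b x t) \<le> C + K"
        using norm_triangle_sub[of "C1_curve a b x t" "C1_curve a b x0 t"] d(1)[OF t] h0_t(1) \<open>K * R \<le> K\<close>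
        by linarith
      show "norm (ddt a b (C1_curve a b x) t) \<le> C + K"
        using norm_triangle_sub[of "ddt a b (C1_curve a b x) t" "ddt a b (C1_curve a b x0) t"] d(2)[OF t] h0_t(2)
        by linarith
      have "\<bar>delta (C1_curve a b x t) - delta (C1_curve a b x0 t)\<bar>
          \<le> D * norm (C1_curve a b x t - C1_curve a b x0 t)"
        using C h0_t(1) K by (intro D(2)) auto
      also have "\<dots> \<le> D * (K * R)" using d(1)[OF t] D(1) by simp
      finally show "c / 2 \<le> \<bar>delta (C1_curve a b x t)\<bar>" using R(3) h0_t(3) by linarith
    qed
  qed
qed

text \<open>
  Along a continuous curve of tuples in general position the determinant is a nowhere vanishing
  continuous function of the curve parameter and of time, hence bounded away from zero on the compact
  rectangle. This puts a whole solution into one set on which the field is Lipschitz, so that Gronwall's inequality gives uniqueness on the whole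
  interval without a continuation argument.
\<close>

lemma nondegenerate_compact_curve:
  fixes A B :: real
  assumes "a < b" "A \<le> B" and y: "continuous_on {A..B} y"
    and gp: "\<And>\<mu>. \<mu> \<in> {A..B} \<Longrightarrow> general_position a b (C1_curve a b (y \<mu>))"
  obtains C c where "c > 0" "\<And>\<mu>. \<mu> \<in> {A..B} \<Longrightarrow> C1_curve a b (y \<mu>) \<in> nondegenerate a b C c"
proof -
  let ?S = "Product_Type.Times {A..B} {a..b}"
  let ?h = "\<lambda>p. C1_curve a b (y (fst p)) (snd p)"
  have "continuous_on ?S ?h"
    unfolding continuous_on_def
  proof
    fix p assume p: "p \<in> ?S"
    have "continuous_on ?S (\<lambda>q. y (fst q))"
      by (rule continuous_on_compose2[OF y]) (auto intro!: continuous_intros)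
    then have "((\<lambda>q. y (fst q)) \<longlongrightarrow> y (fst p)) (at p within ?S)"
      using p unfolding continuous_on_def by blast
    then have "((\<lambda>q. y (fst q) - y (fst p)) \<longlongrightarrow> 0) (at p within ?S)"
      by (rule LIM_zero)
    from tendsto_mult_right_zero[OF tendsto_norm_zero[OF this], of "1 + (b - a)"]
    have "((\<lambda>q. ?h q - C1_curve a b (y (fst p)) (snd q)) \<longlongrightarrow> 0) (at p within ?S)"
      by (rule Lim_null_comparison[rotated])
        (auto simp: eventually_at_filter intro!: always_eventually C1_curve_diff_le[OF assms(1)])
    moreover have "continuous_on ?S (\<lambda>q. C1_curve a b (y (fst p)) (snd q))"
      by (rule continuous_on_compose2[OF Omega1_continuous(1)[OF C1_curve_Omega1[OF assms(1)]]])
        (auto intro!: continuous_intros)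
    then have "((\<lambda>q. C1_curve a b (y (fst p)) (snd q)) \<longlongrightarrow> ?h p) (at p within ?S)"
      using p unfolding continuous_on_def by blast
    ultimately show "(?h \<longlongrightarrow> ?h p) (at p within ?S)"
      using tendsto_add by fastforce
  qed
  then have "continuous_on ?S (\<lambda>p. \<bar>delta (?h p)\<bar>)"
    by (intro continuous_intros continuous_on_delta)
  moreover have "compact ?S" "?S \<noteq> {}"
    using assms(1,2) by (simp_all add: compact_Times Times_empty)
  ultimately obtain p where p: "p \<in> ?S" "\<And>q. q \<in> ?S \<Longrightarrow> \<bar>delta (?h p)\<bar> \<le> \<bar>delta (?h q)\<bar>"
    using continuous_attains_inf by (metis (no_types, lifting))
  have "bounded (y ` {A..B})"
    by (intro compact_imp_bounded compact_continuous_image y compact_Icc)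
  then obtain K where K: "\<And>\<mu>. \<mu> \<in> {A..B} \<Longrightarrow> norm (y \<mu>) \<le> K"
    unfolding bounded_iff ball_simps by metis
  have zero: "C1_curve a b 0 t = 0" "ddt a b (C1_curve a b 0) t = 0" if "t \<in> {a..b}" for t
    using that assms(1) by (simp_all add: ddt_C1_curve) (simp add: C1_curve_def)
  show ?thesis
  proof
    show "\<bar>delta (?h p)\<bar> > 0" using gp[of "fst p"] p(1) by (auto simp: general_position_def)
    fix \<mu> assume \<mu>: "\<mu> \<in> {A..B}"
    show "C1_curve a b (y \<mu>) \<in> nondegenerate a b ((1 + (b - a)) * K) \<bar>delta (?h p)\<bar>"
      unfolding nondegenerate_def
    proof (intro CollectI conjI ballI C1_curve_Omega1 assms(1))
      fix t assume t: "t \<in> {a..b}"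
      have "(1 + (b - a)) * norm (y \<mu>) \<le> (1 + (b - a)) * K"
        using K[OF \<mu>] assms(1) by (intro mult_left_mono) auto
      then show "norm (C1_curve a b (y \<mu>) t) \<le> (1 + (b - a)) * K"
        "norm (ddt a b (C1_curve a b (y \<mu>)) t) \<le> (1 + (b - a)) * K"
        using C1_curve_diff_le[OF assms(1) t, of "y \<mu>" 0] unfolding zero[OF t] by simp_all
      show "\<bar>delta (?h p)\<bar> \<le> \<bar>delta (C1_curve a b (y \<mu>) t)\<bar>"
        using p(2)[of "(\<mu>, t)"] \<mu> t by simp
    qed
  qed
qed

text \<open>
  \<open>C1_pair\<close> after \<open>C1_curve\<close> replaces the values outside \<open>[a,b]\<close> of the second component by the
  constant extension. A solution in coordinates need not be of this form, but its image under this
  bounded operator solves the same equation, because the field takes values in the range of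
  \<open>C1_pair\<close>.
\<close>

lemma bounded_linear_pair_curve:
  assumes "a < b"
  shows "bounded_linear (\<lambda>x. C1_pair a b (C1_curve a b x))"
proof (rule bounded_linear_intro[where K = 2])
  have snd: "apply_bcontfun (snd (C1_pair a b (C1_curve a b x))) t = apply_bcontfun (snd x) (clamp a b t)" for x t
    using assms snd_C1_pair[OF Omega1_continuous(2)[OF C1_curve_Omega1]] ddt_C1_curve clamp_Icc(1)
    by (metis less_imp_le)
  have fst: "fst (C1_pair a b (C1_curve a b x)) = fst x" for x
    using assms by (simp add: C1_curve_start)
  show "C1_pair a b (C1_curve a b (x + y)) = C1_pair a b (C1_curve a b x) + C1_pair a b (C1_curve a b y)" for x y
    by (intro prod_eqI bcontfun_eqI) (simp_all add: fst snd del: fst_C1_pair)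
  show "C1_pair a b (C1_curve a b (r *\<^sub>R x)) = r *\<^sub>R C1_pair a b (C1_curve a b x)" for r x
    by (intro prod_eqI bcontfun_eqI) (simp_all add: fst snd del: fst_C1_pair)
  show "norm (C1_pair a b (C1_curve a b x)) \<le> norm x * 2" for x
  proof -
    have "norm (apply_bcontfun (snd x) t) \<le> norm x" for t
      using norm_bounded[of "snd x" t] norm_fst_snd_le(2)[of x] by linarith
    then have "norm (C1_pair a b (C1_curve a b x)) \<le> 2 * norm x"
      by (intro norm_C1_pair_le) (simp_all add: fst snd norm_fst_snd_le del: fst_C1_pair)
    then show ?thesis by simp
  qed
qed

lemma V_plus_solution_pair:
  assumes "a < b" "V_plus_solution a b \<epsilon> \<gamma>" "lam \<in> {-\<epsilon>..\<epsilon>}"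
  shows "C1_curve a b (C1_pair a b (\<gamma> lam)) = \<gamma> lam" "general_position a b (\<gamma> lam)"
    "((\<lambda>\<mu>. C1_pair a b (\<gamma> \<mu>)) has_vector_derivative pair_field a b (C1_pair a b (\<gamma> lam)))
      (at lam within {-\<epsilon>..\<epsilon>})"
proof -
  have \<gamma>: "\<gamma> \<mu> \<in> Omega1 a b" "general_position a b (\<gamma> \<mu>)" if "\<mu> \<in> {-\<epsilon>..\<epsilon>}" for \<mu>
    using assms(2) that by (auto simp: V_plus_solution_def Omega1_tilde_def)
  show inv: "C1_curve a b (C1_pair a b (\<gamma> lam)) = \<gamma> lam"
    by (rule C1_curve_pair[OF assms(1) \<gamma>(1)[OF assms(3)]])
  show "general_position a b (\<gamma> lam)" by (rule \<gamma>(2)[OF assms(3)])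
  have "has_Omega1_derivative a b \<gamma> (V_plus a b lam (\<gamma> lam)) lam {-\<epsilon>..\<epsilon>}"
    using assms(2,3) by (simp add: V_plus_solution_def)
  then show "((\<lambda>\<mu>. C1_pair a b (\<gamma> \<mu>)) has_vector_derivative pair_field a b (C1_pair a b (\<gamma> lam)))
      (at lam within {-\<epsilon>..\<epsilon>})"
    using has_Omega1_derivative_iff[OF assms(1) \<gamma>(1) assms(3) V_plus_Omega1[OF assms(1) \<gamma>[OF assms(3)]]]
    by (simp add: pair_field_def inv V_plus_autonomous[of a b lam])
qed

lemma V_plus_solution_unique:
  assumes "a < b" "0 \<le> \<epsilon>" and \<gamma>1: "V_plus_solution a b \<epsilon> \<gamma>1" and \<gamma>2: "V_plus_solution a b \<epsilon> \<gamma>2"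
    and "\<gamma>1 0 = \<gamma>2 0"
  shows "\<gamma>1 = \<gamma>2"
proof -
  note props = V_plus_solution_pair[OF assms(1)]
  have cover: "\<exists>C c. c > 0 \<and> (\<forall>\<mu>\<in>{-\<epsilon>..\<epsilon>}. \<gamma> \<mu> \<in> nondegenerate a b C c)"
    if \<gamma>: "V_plus_solution a b \<epsilon> \<gamma>" for \<gamma>
  proof -
    have "continuous_on {-\<epsilon>..\<epsilon>} (\<lambda>\<mu>. C1_pair a b (\<gamma> \<mu>))"
      using props(3)[OF \<gamma>] has_vector_derivative_continuous
      unfolding continuous_on_eq_continuous_within by blast
    then obtain C c where "c > 0" "\<And>\<mu>. \<mu> \<in> {-\<epsilon>..\<epsilon>} \<Longrightarrow>
        C1_curve a b (C1_pair a b (\<gamma> \<mu>)) \<in> nondegenerate a b C c"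
      by (rule nondegenerate_compact_curve[OF assms(1), rotated])
        (use assms(2) props(1,2)[OF \<gamma>] in auto)
    then show ?thesis using props(1)[OF \<gamma>] by metis
  qed
  obtain C1 c1 where c1: "c1 > 0" "\<And>\<mu>. \<mu> \<in> {-\<epsilon>..\<epsilon>} \<Longrightarrow> \<gamma>1 \<mu> \<in> nondegenerate a b C1 c1"
    using cover[OF \<gamma>1] by blast
  obtain C2 c2 where c2: "c2 > 0" "\<And>\<mu>. \<mu> \<in> {-\<epsilon>..\<epsilon>} \<Longrightarrow> \<gamma>2 \<mu> \<in> nondegenerate a b C2 c2"
    using cover[OF \<gamma>2] by blast
  define C c where "C = max C1 C2" and "c = min c1 c2"
  have c: "c > 0" using c1(1) c2(1) by (simp add: c_def)
  have mem: "\<gamma>1 \<mu> \<in> nondegenerate a b C c" "\<gamma>2 \<mu> \<in> nondegenerate a b C c" if "\<mu> \<in> {-\<epsilon>..\<epsilon>}" for \<mu>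
    using c1(2)[OF that] c2(2)[OF that] nondegenerate_mono[of C1 C c c1 a b] nondegenerate_mono[of C2 C c c2 a b]
    by (auto simp: C_def c_def)
  let ?U = "{x. C1_curve a b x \<in> nondegenerate a b C c}"
  obtain L where L: "L > 0" "\<And>x y. x \<in> ?U \<Longrightarrow> y \<in> ?U \<Longrightarrow>
      norm (pair_field a b x - pair_field a b y) \<le> L * norm (x - y)"
    by (rule pair_field_lipschitz[OF assms(1) c, of C]) simp
  have pair_eq: "C1_pair a b (\<gamma>1 \<mu>) = C1_pair a b (\<gamma>2 \<mu>)" if "\<mu> \<in> {-\<epsilon>..\<epsilon>}" for \<mu>
  proof (rule autonomous_flow_unique[OF L _ props(3)[OF \<gamma>1] _ props(3)[OF \<gamma>2] _ that])
    show "(\<lambda>\<mu>. C1_pair a b (\<gamma>1 \<mu>)) \<in> {-\<epsilon>..\<epsilon>} \<rightarrow> ?U" "(\<lambda>\<mu>. C1_pair a b (\<gamma>2 \<mu>)) \<in> {-\<epsilon>..\<epsilon>} \<rightarrow> ?U"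
      using mem props(1)[OF \<gamma>1] props(1)[OF \<gamma>2] by auto
  qed (use assms(5) in auto)
  show ?thesis
  proof (rule extensionalityI[of _ "{-\<epsilon>..\<epsilon>}"])
    show "\<gamma>1 \<in> extensional {-\<epsilon>..\<epsilon>}" "\<gamma>2 \<in> extensional {-\<epsilon>..\<epsilon>}"
      using \<gamma>1 \<gamma>2 by (auto simp: V_plus_solution_def PiE_def)
    show "\<gamma>1 \<mu> = \<gamma>2 \<mu>" if "\<mu> \<in> {-\<epsilon>..\<epsilon>}" for \<mu>
      using pair_eq[OF that] props(1)[OF \<gamma>1 that] props(1)[OF \<gamma>2 that] by metis
  qed
qed

lemma V_plus_solution_exists:
  assumes "a < b" and h0: "h0 \<in> Omega1_tilde a b" and gp: "general_position a b h0"
  obtains \<epsilon>0 where "\<epsilon>0 > 0" "\<And>\<epsilon>. 0 < \<epsilon> \<Longrightarrow> \<epsilon> \<le> \<epsilon>0 \<Longrightarrow> \<exists>\<gamma>. V_plus_solution a b \<epsilon> \<gamma> \<and> \<gamma> 0 = h0"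
proof -
  let ?F = "pair_field a b"
  define x0 where "x0 = C1_pair a b h0"
  have h0_eq: "C1_curve a b x0 = h0"
    using h0 C1_curve_pair[OF assms(1)] by (simp add: x0_def Omega1_tilde_def)
  obtain R C c where R: "R > 0" and c: "c > 0" and
    ball: "\<And>x. x \<in> cball x0 R \<Longrightarrow> C1_curve a b x \<in> nondegenerate a b C c"
    by (rule nondegenerate_cball[OF assms(1), of x0]) (use gp h0_eq in auto)
  obtain L where L: "L > 0" and lip: "\<And>x y. C1_curve a b x \<in> nondegenerate a b C c \<Longrightarrow>
      C1_curve a b y \<in> nondegenerate a b C c \<Longrightarrow> norm (?F x - ?F y) \<le> L * norm (x - y)"
    by (rule pair_field_lipschitz[OF assms(1) c, of C]) (rule that)
  \<comment> \<open>The summand 1 makes the bound for the field on the ball positive, so that R / M is meaningful.\<close>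
  define M where "M = L * R + norm (?F x0) + 1"
  have M_pos: "M > 0" using L R by (simp add: M_def add_nonneg_pos)
  have M: "norm (?F x) \<le> M" if x: "x \<in> cball x0 R" for x
  proof -
    have "norm (?F x - ?F x0) \<le> L * norm (x - x0)"
      using R by (intro lip ball x) simp
    also have "\<dots> \<le> L * R" using x L by (simp add: dist_norm norm_minus_commute)
    finally show ?thesis using norm_triangle_sub[of "?F x" "?F x0"] by (simp add: M_def)
  qed
  show ?thesis
  proof
    show "R / M > 0" using R M_pos by simp
    fix \<epsilon> assume \<epsilon>: "0 < \<epsilon>" "\<epsilon> \<le> R / M"
    let ?I = "{-\<epsilon>..\<epsilon>}"
    obtain y where y: "y 0 = x0" "y \<in> ?I \<rightarrow> cball x0 R"
      "\<And>t. t \<in> ?I \<Longrightarrow> (y has_vector_derivative ?F (y t)) (at t within ?I)"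
    proof (rule autonomous_flow_exists[of \<epsilon> R M L x0 ?F])
      show "\<epsilon> * M \<le> R" using \<epsilon> M_pos by (simp add: le_divide_eq)
      show "norm (?F x - ?F z) \<le> L * norm (x - z)" if "x \<in> cball x0 R" "z \<in> cball x0 R" for x z
        by (intro lip ball that)
    qed (use \<epsilon> R L M in auto)
    define \<gamma> where "\<gamma> = (\<lambda>\<mu>\<in>?I. C1_curve a b (y \<mu>))"
    have nondeg: "C1_curve a b (y \<mu>) \<in> nondegenerate a b C c" if "\<mu> \<in> ?I" for \<mu>
      using y(2) that by (intro ball) auto
    have y_gp: "general_position a b (C1_curve a b (y \<mu>))" if "\<mu> \<in> ?I" for \<mu>
      by (rule nondegenerate_imp_general_position[OF c nondeg[OF that]])
    have row: "fst (y \<mu>) $ l = h0 a $ l" if "\<mu> \<in> ?I" "l \<noteq> 3" for \<mu> l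
    proof -
      have "((\<lambda>\<mu>. fst (y \<mu>) $ l) has_vector_derivative 0) (at \<mu> within ?I)" if \<mu>: "\<mu> \<in> ?I" for \<mu>
      proof -
        have "((\<lambda>\<mu>. fst (y \<mu>) $ l) has_vector_derivative fst (?F (y \<mu>)) $ l) (at \<mu> within ?I)"
          by (intro bounded_linear.has_vector_derivative[OF bounded_linear_vec_nth]
              bounded_linear.has_vector_derivative[OF bounded_linear_fst] y(3) \<mu>)
        then show ?thesis
          using V_plus_initial_row[OF assms(1) C1_curve_Omega1[OF assms(1)] y_gp[OF \<mu>] \<open>l \<noteq> 3\<close>]
          by (simp add: pair_field_def)
      qed
      then obtain k where "\<And>\<mu>. \<mu> \<in> ?I \<Longrightarrow> fst (y \<mu>) $ l = k"
        by (rule has_vector_derivative_zero_constant[of ?I, rotated]) auto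
      from this[OF that(1)] this[of 0] show ?thesis using \<epsilon> by (simp add: y(1) x0_def)
    qed
    have \<gamma>_mem: "\<gamma> \<mu> \<in> Omega1_tilde a b" "general_position a b (\<gamma> \<mu>)" if "\<mu> \<in> ?I" for \<mu>
      using row[OF that, of 1] row[OF that, of 2] h0 y_gp[OF that] that assms(1)
      by (simp_all add: \<gamma>_def Omega1_tilde_def C1_curve_Omega1 C1_curve_start)
    have "has_Omega1_derivative a b \<gamma> (V_plus a b lam (\<gamma> lam)) lam ?I" if lam: "lam \<in> ?I" for lam
    proof -
      have \<gamma>_Omega1: "\<gamma> \<mu> \<in> Omega1 a b" if "\<mu> \<in> ?I" for \<mu>
        using \<gamma>_mem(1)[OF that] by (simp add: Omega1_tilde_def)
      have V: "V_plus a b lam (\<gamma> lam) \<in> Omega1 a b"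
        by (intro V_plus_Omega1 assms(1) \<gamma>_Omega1 \<gamma>_mem lam)
      have "?F (y lam) = C1_pair a b (V_plus a b lam (\<gamma> lam))"
        using lam by (simp add: pair_field_def \<gamma>_def V_plus_autonomous[of a b lam])
      then have "((\<lambda>\<mu>. C1_pair a b (C1_curve a b (y \<mu>))) has_vector_derivative
          C1_pair a b (V_plus a b lam (\<gamma> lam))) (at lam within ?I)"
        using bounded_linear.has_vector_derivative[OF bounded_linear_pair_curve[OF assms(1)] y(3)[OF lam]]
        by (simp add: C1_curve_pair[OF assms(1) V])
      then have "((\<lambda>\<mu>. C1_pair a b (\<gamma> \<mu>)) has_vector_derivative
          C1_pair a b (V_plus a b lam (\<gamma> lam))) (at lam within ?I)"
        by (rule has_vector_derivative_transform[OF lam, rotated]) (simp add: \<gamma>_def)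
      then show ?thesis
        using has_Omega1_derivative_iff[OF assms(1) \<gamma>_Omega1 lam V] by simp
    qed
    then have "V_plus_solution a b \<epsilon> \<gamma>"
      using \<gamma>_mem by (auto simp: V_plus_solution_def PiE_def \<gamma>_def)
    moreover have "\<gamma> 0 = h0" using \<epsilon> y(1) h0_eq by (simp add: \<gamma>_def)
    ultimately show "\<exists>\<gamma>. V_plus_solution a b \<epsilon> \<gamma> \<and> \<gamma> 0 = h0" by blast
  qed
qed

theorem proposition2p20:
  fixes a b :: real and h0 :: "real \<Rightarrow> real^3^3"
  assumes "a < b"
    and "h0 \<in> Omega1_tilde a b"
    and "general_position a b h0"
  shows "\<exists>\<epsilon>0>0. \<forall>\<epsilon>. 0 < \<epsilon> \<and> \<epsilon> \<le> \<epsilon>0 \<longrightarrow>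
           (\<exists>!\<gamma>. V_plus_solution a b \<epsilon> \<gamma> \<and> \<gamma> 0 = h0)"
proof -
  obtain \<epsilon>0 where "\<epsilon>0 > 0" and ex: "\<And>\<epsilon>. 0 < \<epsilon> \<Longrightarrow> \<epsilon> \<le> \<epsilon>0 \<Longrightarrow> \<exists>\<gamma>. V_plus_solution a b \<epsilon> \<gamma> \<and> \<gamma> 0 = h0"
    by (rule V_plus_solution_exists[OF assms]) (rule that)
  have "\<exists>!\<gamma>. V_plus_solution a b \<epsilon> \<gamma> \<and> \<gamma> 0 = h0" if "0 < \<epsilon>" "\<epsilon> \<le> \<epsilon>0" for \<epsilon>
  proof (rule ex_ex1I[OF ex[OF that]])
    show "\<gamma> = \<gamma>'" if "V_plus_solution a b \<epsilon> \<gamma> \<and> \<gamma> 0 = h0" "V_plus_solution a b \<epsilon> \<gamma>' \<and> \<gamma>' 0 = h0"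
      for \<gamma> \<gamma>'
      using that \<open>0 < \<epsilon>\<close> by (intro V_plus_solution_unique[OF assms(1), of \<epsilon>]) auto
  qed
  with \<open>\<epsilon>0 > 0\<close> show ?thesis by blast
qed

end
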